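(* Let $n_{2}=n_{2}(n_{1})\geq n_{1}$ and $p=p(n_{1})\in[0,1]$ be functions of $n_{1}\in\mathbb{N}$ such that $$\sqrt{n_{1}p}\,\log^{3}(n_{1})=o(n_{1}p)\quad\text{and}\quad \sqrt{n_{2}p}\,\log^{3}(n_{2})=o(n_{2}p)$$ as $n_{1}\to\infty$. Let $G\sim G(n_{1},n_{2},p)$ and let $A(G)$ be its adjacency matrix. Then there is a sequence $\varepsilon_{n_{1}}\to 0$ such that, with probability tending to $1$ as $n_{1}\to\infty$, $$\mu_{2}(A(G))\leq 2(1+\varepsilon_{n_{1}})\Big(\sqrt{(n_{1}+n_{2})p}+\sqrt{n_{1}p}+\sqrt{n_{2}p}\Big).$$ Moreover, there is a sequence $\varepsilon'_{n_{1}}\to 0$ such that, with probability tending to $1$ as $n_{1}\to\infty$, $$\max_{i\neq 1,\,n_{1}+n_{2}}\big|\mu_{i}(G)-1\big|\leq 2(1+\varepsilon'_{n_{1}})\Big(\sqrt{\tfrac{1}{n_{1}p}+\tfrac{1}{n_{2}p}}+\tfrac{1}{\sqrt{n_{1}p}}+\tfrac{1}{\sqrt{n_{2}p}}\Big).$$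
   Context: For $f,g:\mathbb{N}\to\mathbb{R}_{+}$, $f=o(g)$ means $f(n)/g(n)\to 0$ as $n\to\infty$. The Erdős–Rényi random bipartite graph $G(n_{1},n_{2},p)$ (with $n_{2}\geq n_{1}$) is the random graph with vertex set $V_{1}\sqcup V_{2}$, $V_{1}=\{u_{1},\dots,u_{n_{1}}\}$, $V_{2}=\{v_{1},\dots,v_{n_{2}}\}$, in which each edge $(u_{i},v_{j})$ is present independently with probability $p$, and there are no other edges. For a symmetric real $n\times n$ matrix $M$, its eigenvalues are ordered $\mu_{1}(M)\geq\mu_{2}(M)\geq\dots\geq\mu_{n}(M)$. For a graph $G$ on $n$ vertices with adjacency matrix $A=A(G)$ and diagonal degree matrix $D=D(G)$ (entries the vertex degrees; assumed to have no isolated vertices so $D^{-1/2}$ is defined), $\mu_{i}(G):=\mu_{i}(I-D^{-1/2}AD^{-1/2})$ for $i=1,\dots,n$. *)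

theory Defs
  imports
    "HOL-Probability.Probability"
    "HOL-Probability.Product_PMF"
    "Jordan_Normal_Form.Char_Poly"
begin

text \<open>
  The functions compared by \<open>f = o(g)\<close> take values in \<open>\<real>\<^sub>+\<close>, so that
  \<open>f n / g n\<close> makes sense; the positivity of \<open>g\<close> is needed only for large \<open>n\<close>, and is
  stated explicitly because division by zero yields zero in HOL.
\<close>
definition little_o :: "(nat \<Rightarrow> real) \<Rightarrow> (nat \<Rightarrow> real) \<Rightarrow> bool" where
  "little_o f g \<longleftrightarrow>
     (\<forall>\<^sub>F n in sequentially. g n > 0) \<and> (\<lambda>n. f n / g n) \<longlonglongrightarrow> 0"

text \<open>
  \<open>mu i M\<close> is the \<open>i\<close>-th largest eigenvalue (\<open>1 \<le> i \<le> n\<close>) of a real symmetric \<open>n \<times> n\<close> matrix: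
  for such a matrix the characteristic polynomial splits over the reals, so the list below
  has length \<open>n\<close> and contains every eigenvalue with its multiplicity.
\<close>
definition mu :: "nat \<Rightarrow> real mat \<Rightarrow> real" where
  "mu i M = rev (sorted_list_of_multiset (proots (char_poly M))) ! (i - 1)"

text \<open>
  A graph on the vertex set \<open>{0..<n}\<close> is given by \<open>n\<close> and its set of edges, each edge being the
  set of its two endpoints.
\<close>
definition adjacency_matrix :: "nat \<Rightarrow> nat set set \<Rightarrow> real mat" where
  "adjacency_matrix n E = Matrix.mat n n (\<lambda>(i, j). if {i, j} \<in> E then 1 else 0)"

definition vertex_degree :: "nat set set \<Rightarrow> nat \<Rightarrow> nat" where
  "vertex_degree E v = card {e \<in> E. v \<in> e}"

text \<open>
  The matrix \<open>D\<^sup>-\<^sup>1\<^sup>/\<^sup>2\<close>. An isolated vertex, for which the entry is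
  mathematically undefined, gets the entry \<open>1 / sqrt 0 = 0\<close>. It then contributes an eigenvalue
  1 to \<open>I - D\<^sup>-\<^sup>1\<^sup>/\<^sup>2 A D\<^sup>-\<^sup>1\<^sup>/\<^sup>2\<close>.
\<close>
definition inv_sqrt_degree_matrix :: "nat \<Rightarrow> nat set set \<Rightarrow> real mat" where
  "inv_sqrt_degree_matrix n E = mat_diag n (\<lambda>v. 1 / sqrt (real (vertex_degree E v)))"

definition normalized_laplacian :: "nat \<Rightarrow> nat set set \<Rightarrow> real mat" where
  "normalized_laplacian n E =
     1\<^sub>m n - inv_sqrt_degree_matrix n E * adjacency_matrix n E * inv_sqrt_degree_matrix n E"

definition mu_graph :: "nat \<Rightarrow> nat \<Rightarrow> nat set set \<Rightarrow> real" where
  "mu_graph i n E = mu i (normalized_laplacian n E)"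

text \<open>
  The distribution of the edge set of \<open>G(n\<^sub>1, n\<^sub>2, p)\<close>. The vertices
  \<open>u\<^sub>1, \<dots>\<close> of \<open>V\<^sub>1\<close> are \<open>0, \<dots>, n1 - 1\<close>, and the vertices \<open>v\<^sub>1, \<dots>\<close> of \<open>V\<^sub>2\<close> are
  \<open>n1, \<dots>, n1 + n2 - 1\<close>.
\<close>
definition random_bipartite :: "nat \<Rightarrow> nat \<Rightarrow> real \<Rightarrow> nat set set pmf" where
  "random_bipartite n1 n2 p =
     map_pmf (\<lambda>X. {{i, n1 + j} | i j. i < n1 \<and> j < n2 \<and> X (i, j)})
       (Pi_pmf ({..<n1} \<times> {..<n2}) False (\<lambda>_. bernoulli_pmf p))"

end

theory Submission
  imports Defs "Jordan_Normal_Form.Schur_Decomposition"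
begin

text \<open>
  Both bounds hold with \<open>\<epsilon> = \<epsilon>' = 0\<close>, because their right-hand sides exceed the true order of
  magnitude by a constant factor. Let \<open>X\<close> be the centred adjacency matrix.
  The expected trace of \<open>X ^ (2 * m)\<close> with \<open>m\<close> of order \<open>log n2\<close> is a sum over closed walks in which
  every edge is traversed at least twice. Revealing a walk step by step and controlling it by a
  potential function shows that each step contributes a factor of at most
  \<open>2 * sqrt (n2 * p) + O(m\<^sup>2)\<close>, so \<open>\<parallel>X\<parallel> \<le> (9 / 4) * sqrt (n2 * p)\<close> with high probability.
  The expectation of the adjacency matrix is a rank-two form \<open>2 (a \<bullet> x) (b \<bullet> x)\<close>, which can only move one
  eigenvalue above and one eigenvalue below the interval given by \<open>\<parallel>X\<parallel>\<close>; this gives the first bound.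

  For the normalized Laplacian, if \<open>n2 \<le> n1 ^ 3\<close> then all degrees are concentrated and the same argument
  applies after rescaling. If \<open>n2 > n1 ^ 3\<close>, the degrees in \<open>V\<^sub>2\<close> need not be concentrated (there
  may even be isolated vertices). In that case the two-step walk matrix on \<open>V\<^sub>1\<close> is a sum of \<open>n2\<close>
  independent exchangeable matrices, and the second moment of its Frobenius distance to the mean is
  small enough.
\<close>

section \<open>Eigenvalues of symmetric matrices\<close>

unbundle no inner_syntax

text \<open>Since n1 is at most n2, the two right-hand sides with zero error terms are at least
  \<open>4 * sqrt (n2 * p)\<close> and \<open>4 / sqrt (n1 * p)\<close>. The room in the first lets
  the trace method treat every vertex as having n2 potential neighbours. The second is met exactly
  by (9/4) / (9/16), where 9/16 is the guaranteed fraction of a mean degree. The case distinction is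
  forced: n2 may grow so fast that log n2 exceeds \<open>n1 * p\<close>, and then no union bound
  controls n2 degrees of mean \<open>n1 * p\<close>. The cut at n1^3 is where two failure
  probabilities meet: n2 / n1^4 for the degrees in V2, and n1^2 / n2 for the two-step matrix. Each
  is at most 1 / n1 on its own side of the cut. Walks of length L, of order log n2, need L^2 to be a
  small multiple of \<open>sqrt (n2 * p)\<close>. The hypothesis offers three logarithms, and the
  third absorbs the constants.\<close>

lemma symmetric_real_eigenvalue:
  fixes A :: "real mat" and c :: complex
  assumes A: "A \<in> carrier_mat n n" and sym: "transpose_mat A = A"
    and ev: "eigenvalue (map_mat complex_of_real A) c"
  shows "c \<in> \<real>"
proof -
  let ?A = "map_mat complex_of_real A"
  obtain v where v: "v \<in> carrier_vec n" "v \<noteq> 0\<^sub>v n" "?A *\<^sub>v v = c \<cdot>\<^sub>v v"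
    using ev A unfolding eigenvalue_def eigenvector_def by auto
  have AA: "?A \<in> carrier_mat n n" using A by auto
  have tr: "transpose_mat ?A = ?A" using sym A by (intro eq_matI) (auto, metis carrier_matD index_transpose_mat(1))
  have conj: "conjugate (?A *\<^sub>v v) = ?A *\<^sub>v conjugate v"
    using A v(1) by (intro eq_vecI) (auto simp: scalar_prod_def sum_conjugate conjugate_dist_mul)
  have "c * (v \<bullet>c v) = (?A *\<^sub>v v) \<bullet>c v"
    using v by simp
  also have "\<dots> = (transpose_mat ?A *\<^sub>v v) \<bullet> conjugate v" using tr by simp
  also have "\<dots> = v \<bullet> (?A *\<^sub>v conjugate v)"
    using transpose_vec_mult_scalar[OF AA _ v(1), of "conjugate v"] v(1) AA
    by auto
  also have "\<dots> = v \<bullet>c (?A *\<^sub>v v)" using conj by simp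
  also have "\<dots> = cnj c * (v \<bullet>c v)"
    using v by (simp add: conjugate_smult_vec)
  finally have "c = cnj c" using v by auto
  thus ?thesis by (metis Reals_cnj_iff)
qed

text \<open>\<open>mu\<close> indexes the list of real roots; splitting over the reals is what gives
  that list length \<open>n\<close>.\<close>

lemma symmetric_char_poly_splits:
  fixes A :: "real mat"
  assumes A: "A \<in> carrier_mat n n" and sym: "transpose_mat A = A"
  obtains es where "char_poly A = (\<Prod>a\<leftarrow>es. [:- a, 1:])" "length es = n"
proof -
  interpret of_real_poly: map_poly_inj_comm_ring_hom complex_of_real ..
  let ?A = "map_mat complex_of_real A"
  have AA: "?A \<in> carrier_mat n n" using A by auto
  from char_poly_factorized[OF AA] obtain as where
    as: "char_poly ?A = (\<Prod>a\<leftarrow>as. [:- a, 1:])" "length as = n" by auto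
  have real: "of_real (Re a) = a" if "a \<in> set as" for a
  proof -
    have "poly (char_poly ?A) a = 0"
      unfolding as poly_prod_list using that by (auto simp: prod_list_zero_iff)
    hence "eigenvalue ?A a" using eigenvalue_root_char_poly[OF AA] by simp
    from symmetric_real_eigenvalue[OF A sym this] show ?thesis by simp
  qed
  have "map_poly complex_of_real (char_poly A) = char_poly ?A"
    by (rule of_real_hom.char_poly_hom[OF A, symmetric])
  also have "\<dots> = (\<Prod>a\<leftarrow>as. map_poly complex_of_real [:- Re a, 1:])"
    unfolding as by (intro arg_cong[of _ _ prod_list] map_cong) (auto simp: real)
  also have "\<dots> = map_poly complex_of_real (\<Prod>a\<leftarrow>map Re as. [:- a, 1:])"
    by (simp add: of_real_poly.hom_prod_list o_def)
  finally have "char_poly A = (\<Prod>a\<leftarrow>map Re as. [:- a, 1:])"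
    using of_real_poly.injectivity by blast
  thus ?thesis using as(2) by (intro that[of "map Re as"]) auto
qed

text \<open>The two eigenvalues may coincide, so orthogonality cannot come from their being
  distinct. The first two columns of the Schur basis span an invariant plane. The part of the second
  column orthogonal to the first is again an eigenvector, because symmetry removes the off-diagonal
  coefficient.\<close>

lemma symmetric_orthogonal_eigenvectors:
  fixes A :: "real mat"
  assumes A: "A \<in> carrier_mat n n" and sym: "transpose_mat A = A"
    and cp: "char_poly A = (\<Prod>a\<leftarrow>e1 # e2 # es. [:- a, 1:])"
  obtains u v where "u \<in> carrier_vec n" "v \<in> carrier_vec n" "u \<noteq> 0\<^sub>v n" "v \<noteq> 0\<^sub>v n"
    "A *\<^sub>v u = e1 \<cdot>\<^sub>v u" "A *\<^sub>v v = e2 \<cdot>\<^sub>v v" "u \<bullet> v = 0"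
proof -
  obtain B P Q where "schur_decomposition A (e1 # e2 # es) = (B, P, Q)"
    by (cases "schur_decomposition A (e1 # e2 # es)") auto
  from schur_decomposition[OF A cp this] have
    wit: "similar_mat_wit A B P Q" and ut: "upper_triangular B" and dg: "diag_mat B = e1 # e2 # es"
    by auto
  from similar_mat_witD2[OF A wit] have
    PQ: "P * Q = 1\<^sub>m n" "Q * P = 1\<^sub>m n" "A = P * B * Q"
    and B: "B \<in> carrier_mat n n" and P: "P \<in> carrier_mat n n" and Q: "Q \<in> carrier_mat n n" by auto
  have n: "n = length es + 2" using dg B unfolding diag_mat_def
    by (metis One_nat_def add_Suc_right add.right_neutral carrier_matD(1) diff_zero length_Cons length_map length_upt one_add_one)
  have AP: "A * P = P * B"
    unfolding PQ(3) using PQ(2) B P Q by (simp add: assoc_mult_mat[of _ n n _ n _ n])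
  have B00: "B $$ (0,0) = e1" and B11: "B $$ (1,1) = e2"
  proof -
    have "diag_mat B ! i = B $$ (i,i)" if "i < n" for i using that B by (simp add: diag_mat_def)
    from this[of 0] this[of 1] show "B $$ (0,0) = e1" "B $$ (1,1) = e2" using dg n by auto
  qed
  define p0 p1 where "p0 = col P 0" and "p1 = col P 1"
  have p0: "p0 \<in> carrier_vec n" and p1: "p1 \<in> carrier_vec n" using P by (auto simp: p0_def p1_def)
  have APcol: "A *\<^sub>v col P j = P *\<^sub>v col B j" if "j < n" for j
    using AP that A P B by (metis col_mult2)
  have Bj: "B $$ (i, j) = 0" if "i < n" "j < i" for i j using ut B that unfolding upper_triangular_def by auto
  have e0: "A *\<^sub>v p0 = e1 \<cdot>\<^sub>v p0"
  proof (rule eq_vecI)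
    fix i assume i: "i < dim_vec (e1 \<cdot>\<^sub>v p0)"
    hence i: "i < n" using p0 by auto
    have "(A *\<^sub>v p0) $ i = (\<Sum>k<n. P $$ (i,k) * B $$ (k,0))"
      unfolding p0_def using APcol[of 0] n P B i by (simp add: scalar_prod_def atLeast0LessThan)
    also have "\<dots> = (\<Sum>k\<in>{0}. P $$ (i,k) * B $$ (k,0))"
      using n by (intro sum.mono_neutral_right) (auto simp: Bj)
    finally show "(A *\<^sub>v p0) $ i = (e1 \<cdot>\<^sub>v p0) $ i" using B00 P i n by (simp add: p0_def)
  qed (use A p0 in auto)
  have e1: "A *\<^sub>v p1 = e2 \<cdot>\<^sub>v p1 + B $$ (0,1) \<cdot>\<^sub>v p0"
  proof (rule eq_vecI)
    fix i assume i: "i < dim_vec (e2 \<cdot>\<^sub>v p1 + B $$ (0,1) \<cdot>\<^sub>v p0)"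
    hence i: "i < n" using p0 by auto
    have "(A *\<^sub>v p1) $ i = (\<Sum>k<n. P $$ (i,k) * B $$ (k,1))"
      unfolding p1_def using APcol[of 1] n P B i by (simp add: scalar_prod_def atLeast0LessThan)
    also have "\<dots> = (\<Sum>k\<in>{0,1}. P $$ (i,k) * B $$ (k,1))"
      using n by (intro sum.mono_neutral_right) (auto simp: Bj)
    finally show "(A *\<^sub>v p1) $ i = (e2 \<cdot>\<^sub>v p1 + B $$ (0,1) \<cdot>\<^sub>v p0) $ i"
      using B11 P i n by (simp add: p0_def p1_def)
  qed (use A p0 p1 in auto)
  have QPj: "Q *\<^sub>v col P j = unit_vec n j" if "j < n" for j
    using col_mult2[OF Q P that] PQ(2) that by simp
  have QP: "Q *\<^sub>v p0 = unit_vec n 0" "Q *\<^sub>v p1 = unit_vec n 1"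
    unfolding p0_def p1_def by (rule QPj, simp add: n)+
  have Q0: "Q *\<^sub>v 0\<^sub>v n = 0\<^sub>v n" using Q by (intro eq_vecI) auto
  have p0n: "p0 \<noteq> 0\<^sub>v n"
  proof
    assume "p0 = 0\<^sub>v n"
    hence "unit_vec n 0 = (0\<^sub>v n :: real vec)" using QP(1) Q0 by simp
    hence "unit_vec n 0 $ 0 = (0\<^sub>v n :: real vec) $ 0" by simp
    thus False using n by simp
  qed
  have p00: "p0 \<bullet> p0 \<noteq> 0" using p0 p0n by (simp add: conjugate_square_eq_0_vec[of p0 n, symmetric])
  define t where "t = (p1 \<bullet> p0) / (p0 \<bullet> p0)"
  define v where "v = p1 - t \<cdot>\<^sub>v p0"
  have v: "v \<in> carrier_vec n" using p0 p1 by (auto simp: v_def)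
  have orth: "v \<bullet> p0 = 0"
    unfolding v_def using p0 p1 p00 by (simp add: minus_scalar_prod_distrib t_def)
  have vn: "v \<noteq> 0\<^sub>v n"
  proof
    assume "v = 0\<^sub>v n"
    hence *: "Q *\<^sub>v v = 0\<^sub>v n" using Q0 by simp
    have "Q *\<^sub>v v = unit_vec n 1 - t \<cdot>\<^sub>v unit_vec n 0"
      unfolding v_def using Q p0 p1 QP by (simp add: mult_minus_distrib_mat_vec mult_mat_vec)
    hence "(unit_vec n 1 - t \<cdot>\<^sub>v unit_vec n 0) $ 1 = (0\<^sub>v n :: real vec) $ 1" using * by simp
    thus False using n by simp
  qed
  \<comment> \<open>The off-diagonal coefficient left after orthogonalisation. It vanishes because
    the inner product of \<open>p0\<close> with the image of \<open>v\<close> is computed twice: by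
    symmetry, giving 0, and by expansion, giving \<open>b * (p0 \<bullet> p0)\<close>.\<close>
  define b where "b = B $$ (0,1) + t * e2 - t * e1"
  have Av: "A *\<^sub>v v = e2 \<cdot>\<^sub>v v + b \<cdot>\<^sub>v p0"
  proof -
    have "A *\<^sub>v v = A *\<^sub>v p1 - t \<cdot>\<^sub>v (A *\<^sub>v p0)"
      unfolding v_def using A p0 p1 by (simp add: mult_minus_distrib_mat_vec mult_mat_vec)
    thus ?thesis unfolding e0 e1 using p0 p1 by (intro eq_vecI) (auto simp: v_def b_def algebra_simps)
  qed
  have "(A *\<^sub>v v) \<bullet> p0 = e1 * (v \<bullet> p0)"
  proof -
    have "(transpose_mat A *\<^sub>v v) \<bullet> p0 = v \<bullet> (A *\<^sub>v p0)"
      by (rule transpose_vec_mult_scalar[OF A p0 v])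
    thus ?thesis using sym e0 v p0 by simp
  qed
  moreover have "(A *\<^sub>v v) \<bullet> p0 = e2 * (v \<bullet> p0) + b * (p0 \<bullet> p0)"
    unfolding Av using v p0 by (simp add: add_scalar_prod_distrib[of _ n])
  ultimately have "b = 0" using orth p00 by simp
  hence "A *\<^sub>v v = e2 \<cdot>\<^sub>v v" using Av v p0 by auto
  thus ?thesis using that[of p0 v] p0 v p0n vn e0 orth comm_scalar_prod[OF v p0] by simp
qed

definition quad_form :: "nat \<Rightarrow> (nat \<Rightarrow> nat \<Rightarrow> real) \<Rightarrow> (nat \<Rightarrow> real) \<Rightarrow> real" where
  "quad_form n a x = (\<Sum>i<n. \<Sum>j<n. a i j * x i * x j)"

lemma quad_form_mat:
  assumes "A \<in> carrier_mat n n" "x \<in> carrier_vec n"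
  shows "quad_form n (\<lambda>i j. A $$ (i, j)) (\<lambda>i. x $ i) = x \<bullet> (A *\<^sub>v x)"
  using assms unfolding quad_form_def
  by (auto simp: scalar_prod_def atLeast0LessThan sum_distrib_left mult_ac intro!: sum.cong)

text \<open>The span of two orthogonal eigenvectors meets the hyperplane \<open>a \<bullet> x = - b \<bullet> x\<close>, on which the
  rank-two term is nonpositive.\<close>
lemma second_eigenvalue_le:
  fixes A :: "real mat"
  assumes A: "A \<in> carrier_mat n n" and sym: "transpose_mat A = A"
    and cp: "char_poly A = (\<Prod>a\<leftarrow>e1 # e2 # es. [:- a, 1:])" and le: "e2 \<le> e1"
    and qf: "\<And>x. quad_form n (\<lambda>i j. A $$ (i, j)) x
           \<le> t * (\<Sum>i<n. (x i)\<^sup>2) + 2 * (\<Sum>i<n. a i * x i) * (\<Sum>i<n. b i * x i)"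
  shows "e2 \<le> t"
proof -
  obtain u v where uv: "u \<in> carrier_vec n" "v \<in> carrier_vec n" "u \<noteq> 0\<^sub>v n" "v \<noteq> 0\<^sub>v n"
    "A *\<^sub>v u = e1 \<cdot>\<^sub>v u" "A *\<^sub>v v = e2 \<cdot>\<^sub>v v" "u \<bullet> v = 0"
    by (rule symmetric_orthogonal_eigenvectors[OF A sym cp])
  have vu: "v \<bullet> u = 0" using uv comm_scalar_prod by metis
  have up: "u \<bullet> u > 0" "v \<bullet> v > 0"
    using uv conjugate_square_greater_0_vec[of u n] conjugate_square_greater_0_vec[of v n] by auto
  define w where "w = vec n (\<lambda>i. a i + b i)"
  have w: "w \<in> carrier_vec n" by (simp add: w_def)
  obtain \<alpha> \<gamma> where ag: "\<alpha> * (w \<bullet> u) + \<gamma> * (w \<bullet> v) = 0" "\<alpha> \<noteq> 0 \<or> \<gamma> \<noteq> 0"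
  proof (cases "w \<bullet> u = 0")
    case True thus ?thesis using that[of 1 0] by simp
  next
    case False thus ?thesis using that[of "- (w \<bullet> v)" "w \<bullet> u"] by simp
  qed
  define x where "x = \<alpha> \<cdot>\<^sub>v u + \<gamma> \<cdot>\<^sub>v v"
  have x: "x \<in> carrier_vec n" using uv by (simp add: x_def)
  have wx: "w \<bullet> x = 0"
    unfolding x_def using uv w ag by (simp add: scalar_prod_add_distrib[of _ n])
  have Ax: "A *\<^sub>v x = (\<alpha> * e1) \<cdot>\<^sub>v u + (\<gamma> * e2) \<cdot>\<^sub>v v"
    unfolding x_def using A uv by (simp add: mult_add_distrib_mat_vec[of _ n n] mult_mat_vec smult_smult_assoc)
  have xAx: "x \<bullet> (A *\<^sub>v x) = \<alpha>\<^sup>2 * e1 * (u \<bullet> u) + \<gamma>\<^sup>2 * e2 * (v \<bullet> v)"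
    unfolding Ax unfolding x_def using uv vu
    by (simp add: scalar_prod_add_distrib[of _ n] add_scalar_prod_distrib[of _ n] power2_eq_square)
  have xx: "x \<bullet> x = \<alpha>\<^sup>2 * (u \<bullet> u) + \<gamma>\<^sup>2 * (v \<bullet> v)"
    unfolding x_def using uv vu
    by (simp add: scalar_prod_add_distrib[of _ n] add_scalar_prod_distrib[of _ n] power2_eq_square)
  have pos: "x \<bullet> x > 0"
    unfolding xx using ag(2) up by (auto intro: add_pos_nonneg add_nonneg_pos)
  have "e2 * (x \<bullet> x) \<le> x \<bullet> (A *\<^sub>v x)"
    unfolding xAx xx using le up by (auto simp: algebra_simps intro!: mult_left_mono mult_right_mono)
  also have "\<dots> = quad_form n (\<lambda>i j. A $$ (i, j)) (\<lambda>i. x $ i)"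
    using quad_form_mat[OF A x] by simp
  also have "\<dots> \<le> t * (\<Sum>i<n. (x $ i)\<^sup>2) + 2 * (\<Sum>i<n. a i * x $ i) * (\<Sum>i<n. b i * x $ i)"
    by (rule qf)
  also have "(\<Sum>i<n. (x $ i)\<^sup>2) = x \<bullet> x"
    using x by (simp add: scalar_prod_def atLeast0LessThan power2_eq_square)
  also have "(\<Sum>i<n. b i * x $ i) = - (\<Sum>i<n. a i * x $ i)"
    using wx x by (simp add: w_def scalar_prod_def atLeast0LessThan algebra_simps sum.distrib)
  finally have "e2 * (x \<bullet> x) \<le> t * (x \<bullet> x) - 2 * (\<Sum>i<n. a i * x $ i)\<^sup>2"
    by (simp add: power2_eq_square)
  hence "e2 * (x \<bullet> x) \<le> t * (x \<bullet> x)" by (smt (verit) zero_le_power2)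
  thus ?thesis using pos by simp
qed

text \<open>Turns an upper bound for eigenvalues of the negated matrix into a lower bound. The Schur
  form suffices, since negation preserves both similarity and triangularity.\<close>

lemma char_poly_uminus_roots:
  fixes A :: "real mat"
  assumes A: "A \<in> carrier_mat n n"
    and cp: "char_poly A = (\<Prod>a\<leftarrow>es. [:- a, 1:])"
  shows "char_poly (- A) = (\<Prod>a\<leftarrow>map uminus es. [:- a, 1:])"
proof -
  obtain B P Q where "schur_decomposition A es = (B, P, Q)"
    by (cases "schur_decomposition A es") auto
  from schur_decomposition[OF A cp this] have
    wit: "similar_mat_wit A B P Q" and ut: "upper_triangular B" and dg: "diag_mat B = es"
    by auto
  from similar_mat_witD2[OF A wit] have
    PQ: "P * Q = 1\<^sub>m n" "Q * P = 1\<^sub>m n" "A = P * B * Q"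
    and B: "B \<in> carrier_mat n n" and P: "P \<in> carrier_mat n n" and Q: "Q \<in> carrier_mat n n" by auto
  have "similar_mat_wit (- A) (- B) P Q"
    using PQ A B P Q by (intro similar_mat_witI[of _ _ n]) auto
  hence "char_poly (- A) = char_poly (- B)"
    by (intro char_poly_similar) (auto simp: similar_mat_def)
  also have "\<dots> = (\<Prod>a\<leftarrow>diag_mat (- B). [:- a, 1:])"
    using B ut by (intro char_poly_upper_triangular[of _ n]) (auto simp: upper_triangular_def)
  also have "diag_mat (- B) = map uminus es"
    using dg B by (auto simp: diag_mat_def)
  finally show ?thesis .
qed

text \<open>The product of the linear forms \<open>a\<close> and \<open>b\<close>, doubled, is half
  the square of their sum minus half the square of their difference. It has one positive and one
  negative direction, so one eigenvalue may escape at each end.\<close>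

lemma mu_near:
  fixes M :: "real mat"
  assumes M: "M \<in> carrier_mat n n" and sym: "transpose_mat M = M"
    and qf: "\<And>x. \<bar>quad_form n (\<lambda>i j. M $$ (i, j)) x - s * (\<Sum>i<n. (x i)\<^sup>2)
              - 2 * (\<Sum>i<n. a i * x i) * (\<Sum>i<n. b i * x i)\<bar> \<le> \<beta> * (\<Sum>i<n. (x i)\<^sup>2)"
    and i: "1 < i" "i < n"
  shows "\<bar>mu i M - s\<bar> \<le> \<beta>"
proof -
  define es where "es = rev (sorted_list_of_multiset (proots (char_poly M)))"
  obtain as where as: "char_poly M = (\<Prod>a\<leftarrow>as. [:- a, 1:])" "length as = n"
    by (rule symmetric_char_poly_splits[OF M sym])
  have "proots (\<Prod>a\<leftarrow>as. [:- a, 1:]) = mset as" for as :: "real list"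
  proof (induction as)
    case (Cons a as)
    have "(\<Prod>a\<leftarrow>as. [:- a, 1:]) \<noteq> 0" by (auto simp: prod_list_zero_iff)
    hence "proots ([:- a, 1:] * (\<Prod>a\<leftarrow>as. [:- a, 1:])) = add_mset a (mset as)"
      using Cons by (subst proots_mult) auto
    thus ?case by simp
  qed simp
  hence mas: "mset es = mset as" by (simp add: es_def as)
  have cp: "char_poly M = (\<Prod>a\<leftarrow>bs. [:- a, 1:])" if "mset bs = mset es" for bs
    unfolding as(1) using that mas by (metis prod_mset_prod_list mset_map)
  have len: "length es = n" using mas as(2) by (metis size_mset)
  have srt: "es ! j \<ge> es ! k" if "j \<le> k" "k < n" for j k
    using that len unfolding es_def by (intro sorted_rev_nth_mono) auto
  have mu: "mu i M = es ! (i - 1)" by (simp add: mu_def es_def)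
  \<comment> \<open>\<open>second_eigenvalue_le\<close> only asks that the first listed eigenvalue
    dominate the second, so the list is rearranged to pair the \<open>i\<close>-th one with the
    largest, and with the smallest for \<open>- M\<close>. Removing it from the tail (or from all
    but the last entry) keeps repeated eigenvalues correctly counted.\<close>
  obtain x xs where xs: "es = x # xs" using len i by (cases es) auto
  have "es ! (i - 1) \<in> set xs" using xs len i by (auto simp: nth_Cons split: nat.splits)
  hence m1: "mset (es ! 0 # es ! (i - 1) # remove1 (es ! (i - 1)) xs) = mset es"
    using xs by simp
  obtain ys y where ys: "es = ys @ [y]" using len i by (cases es rule: rev_cases) auto
  have "es ! (i - 1) \<in> set ys" using ys len i by (auto simp: nth_append)
  hence m2: "mset (es ! (n - 1) # es ! (i - 1) # remove1 (es ! (i - 1)) ys) = mset es"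
    using ys len by auto
  have "es ! (i - 1) \<le> s + \<beta>"
  proof (rule second_eigenvalue_le[OF M sym cp[OF m1]])
    show "es ! (i - 1) \<le> es ! 0" using srt i by auto
    show "quad_form n (\<lambda>i j. M $$ (i, j)) x
        \<le> (s + \<beta>) * (\<Sum>i<n. (x i)\<^sup>2) + 2 * (\<Sum>i<n. a i * x i) * (\<Sum>i<n. b i * x i)" for x
      using qf[of x] by (simp add: algebra_simps)
  qed
  moreover have "- (es ! (i - 1)) \<le> \<beta> - s"
  proof (rule second_eigenvalue_le)
    show "char_poly (- M) = (\<Prod>a\<leftarrow>- (es ! (n - 1)) # - (es ! (i - 1)) #
            map uminus (remove1 (es ! (i - 1)) ys). [:- a, 1:])"
      using char_poly_uminus_roots[OF M cp[OF m2]] by simp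
    show "- (es ! (i - 1)) \<le> - (es ! (n - 1))" using srt i by auto
    \<comment> \<open>Changing the sign of \<open>a\<close> alone keeps the rank-two term in the
      required form.\<close>
    have "quad_form n (\<lambda>i j. (- M) $$ (i, j)) x = - quad_form n (\<lambda>i j. M $$ (i, j)) x" for x
      using M by (simp add: quad_form_def sum_negf)
    thus "quad_form n (\<lambda>i j. (- M) $$ (i, j)) x
        \<le> (\<beta> - s) * (\<Sum>i<n. (x i)\<^sup>2) + 2 * (\<Sum>i<n. (- a i) * x i) * (\<Sum>i<n. b i * x i)" for x
      using qf[of x] by (simp add: algebra_simps sum_negf)
    show "transpose_mat (- M) = - M" using sym M by (metis transpose_uminus)
  qed (use M in auto)
  ultimately show ?thesis unfolding mu by linarith
qed

section \<open>The trace method\<close>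

lemma pmf_Markov_inequality:
  fixes u :: "'a \<Rightarrow> real"
  assumes "finite (set_pmf P)" "\<And>x. u x \<ge> 0" "c > 0"
  shows "measure_pmf.prob P {x. u x \<ge> c} \<le> measure_pmf.expectation P u / c"
  using integral_Markov_inequality_measure[of "measure_pmf P" u "{}" c] assms
  by (simp add: integrable_measure_pmf_finite)

section \<open>Powers of symmetric matrices and a norm bound by repeated squaring\<close>

fun mpow :: "nat \<Rightarrow> (nat \<Rightarrow> nat \<Rightarrow> real) \<Rightarrow> nat \<Rightarrow> nat \<Rightarrow> nat \<Rightarrow> real" where
  "mpow n a 0 i j = of_bool (i = j)"
| "mpow n a (Suc l) i j = (\<Sum>k<n. a i k * mpow n a l k j)"

lemma mpow_add:
  assumes "i < n"
  shows "mpow n a (k + l) i j = (\<Sum>h<n. mpow n a k i h * mpow n a l h j)"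
  using assms
proof (induction k arbitrary: i)
  case (Suc k)
  have "mpow n a (Suc k + l) i j = (\<Sum>g<n. \<Sum>h<n. a i g * mpow n a k g h * mpow n a l h j)"
    by (simp add: Suc.IH sum_distrib_left mult.assoc)
  also have "\<dots> = (\<Sum>h<n. mpow n a (Suc k) i h * mpow n a l h j)"
    by (subst sum.swap) (simp add: sum_distrib_right)
  finally show ?case .
qed (simp add: of_bool_def if_distrib[of "\<lambda>x. x * _"] sum.delta cong: if_cong)

lemma mpow_1: "j < n \<Longrightarrow> mpow n a 1 i j = a i j"
  by (simp add: of_bool_def if_distrib[of "\<lambda>x. _ * x"] sum.delta cong: if_cong)

lemma mpow_sym:
  assumes sym: "\<And>i j. i < n \<Longrightarrow> j < n \<Longrightarrow> a i j = a j i" and "i < n" "j < n"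
  shows "mpow n a l i j = mpow n a l j i"
  using assms(2,3)
proof (induction l arbitrary: i j)
  case (Suc l)
  have "mpow n a (Suc l) j i = (\<Sum>h<n. mpow n a l j h * mpow n a 1 h i)"
    using mpow_add[of j n a l 1 i] Suc.prems by simp
  also have "\<dots> = mpow n a (Suc l) i j"
    unfolding mpow.simps(2)[of n a l]
  proof (intro sum.cong refl)
    fix h assume "h \<in> {..<n}"
    thus "mpow n a l j h * mpow n a 1 h i = a i h * mpow n a l h j"
      using Suc.IH[of j h] Suc.prems mpow_1[of i n a h] sym[of h i] by simp
  qed
  finally show ?case ..
qed auto

text \<open>Connects the trace, which expands into closed walks, with the Frobenius norm, which
  controls quadratic forms.\<close>

lemma mpow_frobenius:
  assumes sym: "\<And>i j. i < n \<Longrightarrow> j < n \<Longrightarrow> a i j = a j i"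
  shows "(\<Sum>i<n. \<Sum>j<n. (mpow n a l i j)\<^sup>2) = (\<Sum>i<n. mpow n a (2 * l) i i)"
proof (rule sum.cong)
  fix i assume i: "i \<in> {..<n}"
  have "mpow n a (l + l) i i = (\<Sum>j<n. mpow n a l i j * mpow n a l j i)"
    using i by (intro mpow_add) auto
  also have "\<dots> = (\<Sum>j<n. (mpow n a l i j)\<^sup>2)"
    using i mpow_sym[of n a i _ l, OF sym] by (intro sum.cong) (auto simp: power2_eq_square)
  finally show "(\<Sum>j<n. (mpow n a l i j)\<^sup>2) = mpow n a (2 * l) i i" by (simp add: mult_2)
qed simp

text \<open>Let \<open>y l\<close> be the image of \<open>x\<close> under the \<open>l\<close>-th
  power. By symmetry and Cauchy-Schwarz, the ratio of the squared norm of \<open>y l\<close> to that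
  of \<open>x\<close> is at least squared in size when \<open>l\<close> doubles. Hence the exponent
  is a power of two, and the Frobenius norm enters only at the last power.\<close>

lemma quad_form_le_mpow:
  assumes sym: "\<And>i j. i < n \<Longrightarrow> j < n \<Longrightarrow> a i j = a j i" and \<rho>: "\<rho> \<ge> 0"
    and fr: "(\<Sum>i<n. \<Sum>j<n. (mpow n a (2 ^ t) i j)\<^sup>2) \<le> \<rho> ^ (2 * 2 ^ t)"
  shows "\<bar>quad_form n a x\<bar> \<le> \<rho> * (\<Sum>i<n. (x i)\<^sup>2)"
proof -
  define y where "y l i = (\<Sum>j<n. mpow n a l i j * x j)" for l i
  define N where "N l = (\<Sum>i<n. (y l i)\<^sup>2)" for l
  have N_nonneg: "N l \<ge> 0" for l by (simp add: N_def sum_nonneg)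
  have y0: "y 0 i = x i" if "i < n" for i
    using that by (simp add: y_def of_bool_def if_distrib[of "\<lambda>x. x * _"] sum.delta cong: if_cong)
  have N0: "N 0 = (\<Sum>i<n. (x i)\<^sup>2)" by (simp add: N_def y0)
  have inner: "(\<Sum>i<n. y k i * y l i) = (\<Sum>i<n. x i * y (k + l) i)" for k l
  proof -
    have "(\<Sum>i<n. y k i * y l i) = (\<Sum>i<n. \<Sum>g<n. mpow n a k i g * x g * y l i)"
      by (simp add: y_def[of k] sum_distrib_right)
    also have "\<dots> = (\<Sum>g<n. \<Sum>i<n. x g * (mpow n a k g i * y l i))"
      using mpow_sym[OF sym] by (subst sum.swap) (auto intro!: sum.cong)
    also have "\<dots> = (\<Sum>g<n. x g * y (k + l) g)"
    proof (intro sum.cong refl)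
      fix g assume g: "g \<in> {..<n}"
      have "(\<Sum>i<n. mpow n a k g i * y l i) = (\<Sum>i<n. \<Sum>j<n. mpow n a k g i * mpow n a l i j * x j)"
        by (simp add: y_def sum_distrib_left mult.assoc)
      also have "\<dots> = (\<Sum>j<n. mpow n a (k + l) g j * x j)"
        using g by (subst sum.swap) (simp add: mpow_add sum_distrib_right)
      finally have "(\<Sum>i<n. mpow n a k g i * y l i) = y (k + l) g" by (simp add: y_def)
      thus "(\<Sum>i<n. x g * (mpow n a k g i * y l i)) = x g * y (k + l) g"
        by (simp flip: sum_distrib_left)
    qed
    finally show ?thesis .
  qed
  have cs: "(\<Sum>i<n. x i * y l i)\<^sup>2 \<le> N 0 * N l" for l
    unfolding N0 unfolding N_def by (rule Cauchy_Schwarz_ineq_sum)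
  have step: "(N l)\<^sup>2 \<le> N 0 * N (2 * l)" for l
    using cs[of "2 * l"] inner[of l l] by (simp add: N_def power2_eq_square mult_2)
  have qf: "quad_form n a x = (\<Sum>i<n. x i * y 1 i)"
    unfolding quad_form_def y_def
    by (auto simp: sum_distrib_left mpow_1[unfolded One_nat_def] mult_ac simp del: mpow.simps intro!: sum.cong)
  have last: "N (2 ^ t) \<le> \<rho> ^ (2 * 2 ^ t) * N 0"
  proof -
    have "N (2 ^ t) \<le> (\<Sum>i<n. (\<Sum>j<n. (mpow n a (2 ^ t) i j)\<^sup>2) * (\<Sum>j<n. (x j)\<^sup>2))"
      unfolding N_def y_def by (intro sum_mono Cauchy_Schwarz_ineq_sum)
    also have "\<dots> = (\<Sum>i<n. \<Sum>j<n. (mpow n a (2 ^ t) i j)\<^sup>2) * N 0"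
      by (simp add: N0 sum_distrib_right)
    also have "\<dots> \<le> \<rho> ^ (2 * 2 ^ t) * N 0"
      using fr N_nonneg by (intro mult_right_mono) auto
    finally show ?thesis .
  qed
  show ?thesis
  proof (cases "N 0 = 0")
    case True
    thus ?thesis using cs[of 1] qf N0 by simp
  next
    case False
    hence pos: "N 0 > 0" using N_nonneg[of 0] by simp
    define r where "r s = N (2 ^ s) / N 0" for s
    have r_nonneg: "r s \<ge> 0" for s using N_nonneg pos by (simp add: r_def)
    have r_step: "(r s)\<^sup>2 \<le> r (Suc s)" for s
      using step[of "2 ^ s"] pos by (simp add: r_def power_divide power2_eq_square field_simps)
    have "r 0 ^ (2 ^ s) \<le> r s" for s
    proof (induction s)
      case (Suc s)
      have "r 0 ^ (2 ^ Suc s) = (r 0 ^ (2 ^ s))\<^sup>2" by (simp add: power_mult mult.commute flip: power_mult)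
      also have "\<dots> \<le> (r s)\<^sup>2" using Suc r_nonneg by (intro power_mono) auto
      also have "\<dots> \<le> r (Suc s)" by (rule r_step)
      finally show ?case .
    qed simp
    hence "r 0 ^ (2 ^ t) \<le> r t" .
    also have "\<dots> \<le> (\<rho>\<^sup>2) ^ (2 ^ t)"
      using last pos by (simp add: r_def field_simps flip: power_mult)
    finally have "r 0 \<le> \<rho>\<^sup>2"
      by (rule power_le_imp_le_base[of _ "2 ^ t - 1", simplified]) simp
    hence "N 1 \<le> \<rho>\<^sup>2 * N 0" using pos by (simp add: r_def field_simps)
    hence "(quad_form n a x)\<^sup>2 \<le> N 0 * (\<rho>\<^sup>2 * N 0)"
      using cs[of 1] pos unfolding qf by (smt (verit) mult_left_mono)
    also have "\<dots> = (\<rho> * N 0)\<^sup>2" by (simp add: power2_eq_square)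
    finally have "\<bar>quad_form n a x\<bar> \<le> \<rho> * N 0"
      using \<rho> pos by (simp add: abs_le_square_iff[symmetric] abs_mult)
    thus ?thesis by (simp add: N0)
  qed
qed

section \<open>Bookkeeping of the edges that a walk has traversed exactly once\<close>

definition edge_degree :: "nat set set \<Rightarrow> nat \<Rightarrow> nat" where
  "edge_degree H v = card {e \<in> H. v \<in> e}"

text \<open>On a simple path every summand is 0: inner vertices have degree 2, and the tip
  \<open>w\<close> gets its second unit from the marker \<open>of_bool (v = w)\<close>. Truncated
  subtraction keeps untouched vertices at 0. Every further pair of units at a vertex, such as an
  arrival and a departure, adds one.\<close>

definition excess :: "nat \<Rightarrow> nat set set \<Rightarrow> nat \<Rightarrow> nat" where
  "excess n H w = (\<Sum>v<n. (edge_degree H v + of_bool (v = w) - 1) div 2)"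

lemma edge_degree_insert:
  assumes "finite H" "e \<notin> H"
  shows "edge_degree (insert e H) v = edge_degree H v + of_bool (v \<in> e)"
proof -
  have "{x \<in> insert e H. v \<in> x} = (if v \<in> e then insert e {x \<in> H. v \<in> x} else {x \<in> H. v \<in> x})" by auto
  thus ?thesis using assms by (simp add: edge_degree_def)
qed

text \<open>At \<open>w\<close> the new edge replaces the marker. At \<open>v\<close> the edge and
  the marker add two units, hence one after halving, except at a fresh vertex, where the rounding
  hides them.\<close>

lemma excess_insert:
  assumes "finite H" "{w, v} \<notin> H" "w \<noteq> v" "v < n"
  shows "excess n (insert {w, v} H) v \<le> excess n H w + of_bool (edge_degree H v > 0)"
proof -
  have "excess n (insert {w, v} H) v \<le>
    (\<Sum>u<n. (edge_degree H u + of_bool (u = w) - 1) div 2 + (if u = v then of_bool (edge_degree H v > 0) else 0))"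
    unfolding excess_def using assms by (intro sum_mono) (auto simp: edge_degree_insert)
  thus ?thesis using assms(4) by (simp add: sum.distrib excess_def)
qed

text \<open>At \<open>v\<close> the marker replaces the removed edge. At \<open>w\<close> both
  disappear, which lowers the halved count by one unless this was the only edge there.\<close>

lemma excess_remove:
  assumes "finite H" "{w, v} \<in> H" "w \<noteq> v" "w < n"
  shows "excess n (H - {{w, v}}) v + of_bool (edge_degree H w \<ge> 2) \<le> excess n H w"
proof -
  define H' where "H' = H - {{w, v}}"
  have H: "H = insert {w, v} H'" "{w, v} \<notin> H'" "finite H'" using assms by (auto simp: H'_def)
  have "(\<Sum>u<n. (edge_degree H' u + of_bool (u = v) - 1) div 2 + (if u = w then of_bool (edge_degree H w \<ge> 2) else 0))
     \<le> excess n H w"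
    unfolding excess_def H(1) using H(2,3) assms(3) by (intro sum_mono) (auto simp: edge_degree_insert)
  thus ?thesis using assms(4) by (simp add: sum.distrib excess_def flip: H'_def)
qed

lemma excess_move:
  assumes "v < n"
  shows "excess n H v \<le> excess n H w + 1"
proof -
  have "excess n H v \<le> (\<Sum>u<n. (edge_degree H u + of_bool (u = w) - 1) div 2 + (if u = v then 1 else 0))"
    unfolding excess_def by (intro sum_mono) auto
  thus ?thesis using assms by (simp add: sum.distrib excess_def)
qed

text \<open>\<open>moments\<close> is what independence, mean zero, absolute values at most 1 and
  variance at most \<open>p\<close> provide: a monomial with some exponent 1 has mean zero, and
  otherwise each occurring edge contributes a factor \<open>p\<close>.\<close>

locale random_symmetric_matrix =
  fixes P :: "'a pmf" and Z :: "nat set \<Rightarrow> 'a \<Rightarrow> real" and G :: "nat set set" and n D :: nat and p :: real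
  assumes fin: "finite (set_pmf P)"
    and edges: "\<And>e. e \<in> G \<Longrightarrow> \<exists>u v. e = {u, v} \<and> u \<noteq> v \<and> u < n \<and> v < n"
    and max_degree: "\<And>u. card {v. {u, v} \<in> G} \<le> D"
    and p_nonneg: "0 \<le> p"
    and moments: "\<And>m :: nat set \<Rightarrow> nat. \<bar>measure_pmf.expectation P (\<lambda>\<omega>. \<Prod>e\<in>G. Z e \<omega> ^ m e)\<bar>
          \<le> (if \<exists>e\<in>G. m e = 1 then 0 else p ^ card {e \<in> G. m e > 0})"
begin

definition X :: "'a \<Rightarrow> nat \<Rightarrow> nat \<Rightarrow> real" where
  "X \<omega> u v = (if {u, v} \<in> G then Z {u, v} \<omega> else 0)"

definition monomial :: "(nat set \<Rightarrow> nat) \<Rightarrow> 'a \<Rightarrow> real" where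
  "monomial m \<omega> = (\<Prod>e\<in>G. Z e \<omega> ^ m e)"

text \<open>A state of the exploration: \<open>m\<close> counts the traversals made so far,
  \<open>w\<close> is the current vertex, and \<open>l\<close> steps remain until the walk has to
  end at \<open>w0\<close>. The order of the past steps does not matter.\<close>

definition walk_moment :: "nat \<Rightarrow> nat \<Rightarrow> (nat set \<Rightarrow> nat) \<Rightarrow> nat \<Rightarrow> real" where
  "walk_moment w0 l m w = measure_pmf.expectation P (\<lambda>\<omega>. monomial m \<omega> * mpow n (X \<omega>) l w w0)"

definition nbrs :: "nat \<Rightarrow> nat set" where "nbrs u = {v. {u, v} \<in> G}"

lemma integrable [simp]: "integrable (measure_pmf P) (f :: 'a \<Rightarrow> real)"
  by (rule integrable_measure_pmf_finite[OF fin])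

lemma finite_G: "finite G"
  by (rule finite_subset[of _ "Pow {..<n}"]) (use edges in auto)

lemma edgeD: "{u, v} \<in> G \<Longrightarrow> u \<noteq> v \<and> u < n \<and> v < n"
  using edges[of "{u, v}"] by (auto simp: doubleton_eq_iff)

lemma nbrs_subset: "nbrs u \<subseteq> {..<n}" using edgeD by (auto simp: nbrs_def)

lemma finite_nbrs: "finite (nbrs u)" using nbrs_subset finite_subset by blast

lemma monomial_update:
  assumes "e \<in> G"
  shows "monomial (m(e := Suc (m e))) \<omega> = monomial m \<omega> * Z e \<omega>"
proof -
  have "monomial (m(e := Suc (m e))) \<omega> = Z e \<omega> ^ Suc (m e) * (\<Prod>f\<in>G - {e}. Z f \<omega> ^ m f)"
    unfolding monomial_def using assms finite_G by (subst prod.remove[of _ e]) (auto intro!: prod.cong)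
  also have "\<dots> = monomial m \<omega> * Z e \<omega>"
    unfolding monomial_def using assms finite_G by (subst prod.remove[of G e]) auto
  finally show ?thesis .
qed

lemma walk_moment_Suc:
  "walk_moment w0 (Suc l) m w = (\<Sum>v\<in>nbrs w. walk_moment w0 l (m({w, v} := Suc (m {w, v}))) v)"
proof -
  have "mpow n (X \<omega>) (Suc l) w w0 = (\<Sum>v\<in>nbrs w. Z {w, v} \<omega> * mpow n (X \<omega>) l v w0)" for \<omega>
    unfolding mpow.simps using nbrs_subset
    by (intro sum.mono_neutral_cong_right) (auto simp: X_def nbrs_def)
  hence "monomial m \<omega> * mpow n (X \<omega>) (Suc l) w w0
      = (\<Sum>v\<in>nbrs w. monomial (m({w, v} := Suc (m {w, v}))) \<omega> * mpow n (X \<omega>) l v w0)" for \<omega>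
    by (auto simp: sum_distrib_left monomial_update nbrs_def mult_ac intro!: sum.cong)
  thus ?thesis by (simp add: walk_moment_def)
qed

definition visited :: "(nat set \<Rightarrow> nat) \<Rightarrow> nat set set" where "visited m = {e \<in> G. m e > 0}"
definition once :: "(nat set \<Rightarrow> nat) \<Rightarrow> nat set set" where "once m = {e \<in> G. m e = 1}"

lemma finite_visited: "finite (visited m)" and finite_once: "finite (once m)"
  using finite_G by (auto simp: visited_def once_def)

lemma once_subset: "once m \<subseteq> visited m" by (auto simp: visited_def once_def)

lemma card_once_le: "card (once m) \<le> card (visited m)"
  by (intro card_mono finite_visited once_subset)

lemma edge_degree_once: "edge_degree (once m) v \<le> card (once m)"
  unfolding edge_degree_def by (intro card_mono finite_once) auto

text \<open>Bounds the number of targets at which a new edge can raise the excess; they produce the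
  term \<open>2 * K\<^sup>2\<close> inside \<open>growth\<close>.\<close>

lemma card_touched: "card {v. edge_degree (once m) v > 0} \<le> 2 * card (once m)"
proof -
  have c2: "card e = 2" if "e \<in> once m" for e
    using that edges[of e] by (auto simp: once_def)
  have "{v. edge_degree (once m) v > 0} \<subseteq> \<Union>(once m)"
    by (auto simp: edge_degree_def card_gt_0_iff)
  hence "card {v. edge_degree (once m) v > 0} \<le> card (\<Union>(once m))"
    using c2 finite_once by (intro card_mono finite_Union) (auto intro: card_ge_0_finite)
  also have "\<dots> \<le> (\<Sum>e\<in>once m. card e)" by (rule card_Union_le_sum_card)
  also have "\<dots> = 2 * card (once m)" using c2 by simp
  finally show ?thesis .
qed

lemma finite_touched: "finite {v. edge_degree (once m) v > 0}"
proof -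
  have "{v. edge_degree (once m) v > 0} \<subseteq> {..<n}"
    using edges by (auto simp: edge_degree_def card_gt_0_iff once_def)
  thus ?thesis using finite_subset by blast
qed

lemma inj_pair: "inj_on (\<lambda>v. {w, v}) A" for w :: nat
  by (auto simp: inj_on_def doubleton_eq_iff)

lemma card_edges_at: "card {v \<in> nbrs w. {w, v} \<in> H} \<le> card {e \<in> H. w \<in> e}" if "finite H"
proof -
  have "card {v \<in> nbrs w. {w, v} \<in> H} = card ((\<lambda>v. {w, v}) ` {v \<in> nbrs w. {w, v} \<in> H})"
    by (rule card_image[OF inj_pair, symmetric])
  also have "\<dots> \<le> card {e \<in> H. w \<in> e}" using that by (intro card_mono) auto
  finally show ?thesis .
qed

text \<open>A step of the walk from \<open>w\<close> to \<open>v\<close> uses a new edge, an edge traversed exactly once before, or an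
  edge traversed at least twice before. The factor \<open>c\<close> per singly traversed edge balances the first
  two kinds of steps. A vertex at which several edges are still waiting for their second traversal
  offers a choice of edges, and this choice is paid for by the factor \<open>K\<close> that was gained when the
  walk returned to an already occupied vertex. Counting the current vertex as having one more edge
  makes \<open>excess\<close> change only at such events.\<close>
definition potential :: "real \<Rightarrow> real \<Rightarrow> (nat set \<Rightarrow> nat) \<Rightarrow> nat \<Rightarrow> real" where
  "potential c K m w = p ^ card (visited m) * c ^ card (once m) * K ^ excess n (once m) w"

lemma potential_nonneg: "c > 0 \<Longrightarrow> K \<ge> 0 \<Longrightarrow> potential c K m w \<ge> 0"
  using p_nonneg by (simp add: potential_def)

text \<open>Bounding the cost of a possible extra unit of excess by a sum instead of a power of
  \<open>K\<close> lets the total over all neighbours split into a degree term and a term over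
  touched vertices.\<close>

lemma potential_new:
  assumes e: "{w, v} \<in> G" "m {w, v} = 0" and c: "c > 0" and K: "K \<ge> 1"
  shows "potential c K (m({w, v} := 1)) v
      \<le> potential c K m w * (p * c * (1 + of_bool (edge_degree (once m) v > 0) * K))"
    and "card (visited (m({w, v} := 1))) = Suc (card (visited m))"
proof -
  have v: "visited (m({w, v} := 1)) = insert {w, v} (visited m)" "{w, v} \<notin> visited m"
    and o: "once (m({w, v} := 1)) = insert {w, v} (once m)" "{w, v} \<notin> once m"
    using e by (auto simp: visited_def once_def)
  show cv: "card (visited (m({w, v} := 1))) = Suc (card (visited m))"
    using v finite_visited by simp
  have co: "card (once (m({w, v} := 1))) = Suc (card (once m))"
    using o finite_once by simp
  have "excess n (once (m({w, v} := 1))) v \<le> excess n (once m) w + of_bool (edge_degree (once m) v > 0)"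
    unfolding o(1) using edgeD[OF e(1)] o(2) finite_once by (intro excess_insert) auto
  hence "K ^ excess n (once (m({w, v} := 1))) v \<le> K ^ (excess n (once m) w + of_bool (edge_degree (once m) v > 0))"
    using K by (intro power_increasing) auto
  also have "\<dots> \<le> K ^ excess n (once m) w * (1 + of_bool (edge_degree (once m) v > 0) * K)"
    using K by (auto simp: power_add algebra_simps)
  finally show "potential c K (m({w, v} := 1)) v
      \<le> potential c K m w * (p * c * (1 + of_bool (edge_degree (once m) v > 0) * K))"
    unfolding potential_def cv co using p_nonneg c
    by (simp add: mult_ac mult_left_mono)
qed

text \<open>The conditional factor on the left pays for the choice of the edge. It is
  \<open>K\<close> exactly when \<open>w\<close> has several pending edges, which is when
  \<open>excess_remove\<close> releases a unit.\<close>

lemma potential_second: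
  assumes e: "{w, v} \<in> G" "m {w, v} = 1" and c: "c > 0" and K: "K \<ge> 1"
  shows "potential c K (m({w, v} := 2)) v * (if edge_degree (once m) w \<ge> 2 then K else 1)
      \<le> potential c K m w * (1 / c)"
    and "visited (m({w, v} := 2)) = visited m"
proof -
  show v: "visited (m({w, v} := 2)) = visited m"
    using e by (auto simp: visited_def)
  have o: "once (m({w, v} := 2)) = once m - {{w, v}}" "{w, v} \<in> once m"
    using e by (auto simp: once_def)
  have co: "card (once m) = Suc (card (once (m({w, v} := 2))))"
    unfolding o(1) using o(2) finite_once by (metis card.remove)
  have "excess n (once (m({w, v} := 2))) v + of_bool (edge_degree (once m) w \<ge> 2) \<le> excess n (once m) w"
    unfolding o(1) using edgeD[OF e(1)] o(2) finite_once by (intro excess_remove) auto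
  hence "K ^ (excess n (once (m({w, v} := 2))) v + of_bool (edge_degree (once m) w \<ge> 2)) \<le> K ^ excess n (once m) w"
    using K by (intro power_increasing) auto
  hence "K ^ excess n (once (m({w, v} := 2))) v * (if edge_degree (once m) w \<ge> 2 then K else 1) \<le> K ^ excess n (once m) w"
    by (auto simp: power_add mult_ac split: if_splits)
  hence "p ^ card (visited m) * c ^ card (once (m({w, v} := 2))) *
     (K ^ excess n (once (m({w, v} := 2))) v * (if edge_degree (once m) w \<ge> 2 then K else 1))
     \<le> p ^ card (visited m) * c ^ card (once (m({w, v} := 2))) * K ^ excess n (once m) w"
    using p_nonneg c by (intro mult_left_mono) auto
  thus "potential c K (m({w, v} := 2)) v * (if edge_degree (once m) w \<ge> 2 then K else 1)
      \<le> potential c K m w * (1 / c)"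
    unfolding potential_def v co using c by (simp add: mult_ac)
qed

lemma potential_later:
  assumes e: "{w, v} \<in> G" "m {w, v} \<ge> 2" and c: "c > 0" and K: "K \<ge> 1"
  shows "potential c K (m({w, v} := Suc (m {w, v}))) v \<le> potential c K m w * K"
    and "visited (m({w, v} := Suc (m {w, v}))) = visited m"
proof -
  let ?m = "m({w, v} := Suc (m {w, v}))"
  show v: "visited ?m = visited m"
    using e by (auto simp: visited_def)
  have o: "once ?m = once m"
    using e by (auto simp: once_def)
  have "K ^ excess n (once m) v \<le> K ^ (excess n (once m) w + 1)"
    using K edgeD[OF e(1)] by (intro power_increasing excess_move) auto
  hence "p ^ card (visited m) * c ^ card (once m) * K ^ excess n (once m) v
      \<le> p ^ card (visited m) * c ^ card (once m) * K ^ (excess n (once m) w + 1)"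
    using p_nonneg c by (intro mult_left_mono) auto
  thus "potential c K ?m v \<le> potential c K m w * K"
    unfolding potential_def v o by (simp add: mult_ac)
qed

text \<open>One summand per kind of step: up to \<open>D\<close> new edges, with an extra
  \<open>K\<close> at up to \<open>2 * K\<close> touched targets; second traversals, choice
  included, at cost \<open>1 / c\<close>; and up to \<open>K\<close> later traversals at cost
  \<open>K\<close> each. For \<open>c = 1 / sqrt (D * p)\<close> the main terms add up to
  \<open>2 * sqrt (D * p)\<close>.\<close>

definition growth :: "real \<Rightarrow> real \<Rightarrow> real" where
  "growth c K = p * c * (real D + 2 * K\<^sup>2) + 1 / c + K\<^sup>2"

text \<open>Each step lowers \<open>l\<close> by one and visits at most one new edge, so the bound
  \<open>L\<close> on their sum is invariant. It allows the single number \<open>K = L\<close> to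
  dominate all counts of visited edges at the current vertex.\<close>

lemma walk_moment_bound:
  assumes c: "c > 0" and L: "L \<ge> 1" and "w < n" and "card (visited m) + l \<le> L"
  shows "\<bar>walk_moment w0 l m w\<bar> \<le> growth c (real L) ^ l * potential c (real L) m w"
  using assms(3,4)
proof (induction l arbitrary: m w)
  case 0
  have "\<bar>walk_moment w0 0 m w\<bar> \<le> \<bar>measure_pmf.expectation P (monomial m)\<bar>"
    by (auto simp: walk_moment_def)
  also have "\<dots> \<le> (if \<exists>e\<in>G. m e = 1 then 0 else p ^ card (visited m))"
    using moments[of m] unfolding monomial_def visited_def .
  also have "\<dots> \<le> potential c (real L) m w"
  \<comment> \<open>A walk that ends with a pending edge has moment 0. Otherwise
    \<open>once m\<close> is empty, and the factor in \<open>c\<close>, which may be below 1, drops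
    out of the potential.\<close>
  proof (cases "\<exists>e\<in>G. m e = 1")
    case True
    thus ?thesis using potential_nonneg[OF c, of "real L"] by simp
  next
    case False
    hence "once m = {}" by (auto simp: once_def)
    moreover have "p ^ card (visited m) * 1 \<le> p ^ card (visited m) * real L ^ excess n {} w"
      using L p_nonneg by (intro mult_left_mono one_le_power) auto
    ultimately show ?thesis using False by (simp add: potential_def)
  qed
  finally show ?case by simp
next
  case (Suc l)
  define K where "K = real L"
  have K: "K \<ge> 1" using L by (simp add: K_def)
  define \<phi> where "\<phi> = potential c K m w"
  define g where "g = growth c K ^ l"
  have \<phi>: "\<phi> \<ge> 0" unfolding \<phi>_def using potential_nonneg c K by simp
  have g0: "growth c K \<ge> 0" unfolding growth_def using p_nonneg c by simp
  have g: "g \<ge> 0" unfolding g_def using g0 by simp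
  define T where "T v = \<bar>walk_moment w0 l (m({w, v} := Suc (m {w, v}))) v\<bar>" for v
  define A0 where "A0 = {v \<in> nbrs w. m {w, v} = 0}"
  define A1 where "A1 = {v \<in> nbrs w. m {w, v} = 1}"
  define A2 where "A2 = {v \<in> nbrs w. m {w, v} \<ge> 2}"
  have fins: "finite A0" "finite A1" "finite A2"
    using finite_nbrs by (auto simp: A0_def A1_def A2_def)
  have split: "nbrs w = A0 \<union> (A1 \<union> A2)" "A0 \<inter> (A1 \<union> A2) = {}" "A1 \<inter> A2 = {}"
    by (auto simp: A0_def A1_def A2_def)
  have edge: "{w, v} \<in> G" "v < n" if "v \<in> nbrs w" for v
    using that edgeD by (auto simp: nbrs_def)
  have vis: "card (visited m) \<le> L" using Suc.prems by simp
  have s0: "(\<Sum>v\<in>A0. T v) \<le> g * \<phi> * (p * c * (real D + 2 * K\<^sup>2))"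
  proof -
    define I where "I v = (of_bool (edge_degree (once m) v > 0) :: real)" for v
    have "(\<Sum>v\<in>A0. T v) \<le> (\<Sum>v\<in>A0. g * (\<phi> * (p * c * (1 + I v * K))))"
    proof (rule sum_mono)
      fix v assume "v \<in> A0"
      hence v: "v \<in> nbrs w" "m {w, v} = 0" by (auto simp: A0_def)
      note pn = potential_new[of w v m c K, OF edge(1)[OF v(1)] v(2) c K]
      have "T v \<le> g * potential c K (m({w, v} := 1)) v"
        using Suc.IH[of v "m({w, v} := 1)"] v edge pn(2) Suc.prems
        by (simp add: T_def g_def K_def del: fun_upd_apply)
      also have "\<dots> \<le> g * (\<phi> * (p * c * (1 + I v * K)))"
        using pn(1) g by (intro mult_left_mono) (auto simp: \<phi>_def I_def)
      finally show "T v \<le> g * (\<phi> * (p * c * (1 + I v * K)))" .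
    qed
    also have "\<dots> = g * \<phi> * (p * c) * (real (card A0) + (\<Sum>v\<in>A0. I v) * K)"
      by (simp add: sum_distrib_left sum_distrib_right sum.distrib algebra_simps)
    also have "\<dots> \<le> g * \<phi> * (p * c) * (real D + 2 * K * K)"
    proof (intro mult_left_mono add_mono mult_right_mono)
      have "card A0 \<le> card (nbrs w)" using finite_nbrs by (intro card_mono) (auto simp: A0_def)
      thus "real (card A0) \<le> real D" using max_degree[of w] by (simp add: nbrs_def)
      have "(\<Sum>v\<in>A0. I v) = real (card {v \<in> A0. edge_degree (once m) v > 0})"
        unfolding I_def using fins by (simp add: sum_of_bool_eq Int_def)
      also have "\<dots> \<le> real (card {v. edge_degree (once m) v > 0})"
        using finite_touched by (intro of_nat_mono card_mono) auto
      also have "\<dots> \<le> 2 * K" unfolding K_def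
        using card_touched[of m] card_once_le[of m] vis by linarith
      finally show "(\<Sum>v\<in>A0. I v) \<le> 2 * K" .
    qed (use K g \<phi> p_nonneg c in auto)
    finally show ?thesis by (simp add: power2_eq_square mult_ac)
  qed
  have s1: "(\<Sum>v\<in>A1. T v) \<le> g * \<phi> * (1 / c)"
  proof -
    define k where "k = (if edge_degree (once m) w \<ge> 2 then K else 1)"
    have k: "k > 0" using K by (simp add: k_def)
    have "(\<Sum>v\<in>A1. T v) \<le> (\<Sum>v\<in>A1. g * (\<phi> * (1 / c) / k))"
    proof (rule sum_mono)
      fix v assume "v \<in> A1"
      hence v: "v \<in> nbrs w" "m {w, v} = 1" by (auto simp: A1_def)
      note pn = potential_second[of w v m c K, OF edge(1)[OF v(1)] v(2) c K]
      have "T v \<le> g * potential c K (m({w, v} := 2)) v"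
        using Suc.IH[of v "m({w, v} := 2)"] v edge pn(2) Suc.prems
        by (simp add: T_def g_def K_def numeral_2_eq_2 del: fun_upd_apply)
      also have "\<dots> \<le> g * (\<phi> * (1 / c) / k)"
        using pn(1) g k unfolding \<phi>_def k_def[symmetric]
        by (intro mult_left_mono) (auto simp: pos_le_divide_eq simp del: divide_divide_eq_left)
      finally show "T v \<le> g * (\<phi> * (1 / c) / k)" .
    qed
    also have "\<dots> = g * \<phi> * (1 / c) * (real (card A1) / k)" by simp
    also have "\<dots> \<le> g * \<phi> * (1 / c) * 1"
    proof (intro mult_left_mono)
      have "A1 = {v \<in> nbrs w. {w, v} \<in> once m}" by (auto simp: A1_def once_def nbrs_def)
      hence A1: "card A1 \<le> edge_degree (once m) w"
        using card_edges_at[OF finite_once] by (simp add: edge_degree_def)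
      \<comment> \<open>A single pending edge leaves no choice and \<open>k = 1\<close>; if there
        are several, their number is at most \<open>L = K\<close>.\<close>
      hence "real (card A1) \<le> k"
        using edge_degree_once[of m w] card_once_le[of m] vis by (auto simp: k_def K_def)
      thus "real (card A1) / k \<le> 1" using k by simp
    qed (use g \<phi> c in auto)
    finally show ?thesis by simp
  qed
  have s2: "(\<Sum>v\<in>A2. T v) \<le> g * \<phi> * K\<^sup>2"
  proof -
    have "(\<Sum>v\<in>A2. T v) \<le> (\<Sum>v\<in>A2. g * (\<phi> * K))"
    proof (rule sum_mono)
      fix v assume "v \<in> A2"
      hence v: "v \<in> nbrs w" "m {w, v} \<ge> 2" by (auto simp: A2_def)
      note pn = potential_later[of w v m c K, OF edge(1)[OF v(1)] v(2) c K]
      have "T v \<le> g * potential c K (m({w, v} := Suc (m {w, v}))) v"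
        using Suc.IH[of v "m({w, v} := Suc (m {w, v}))"] v edge pn(2) Suc.prems
        by (simp add: T_def g_def K_def del: fun_upd_apply)
      also have "\<dots> \<le> g * (\<phi> * K)" using pn(1) g by (intro mult_left_mono) (auto simp: \<phi>_def)
      finally show "T v \<le> g * (\<phi> * K)" .
    qed
    also have "\<dots> = g * \<phi> * K * real (card A2)" by simp
    also have "\<dots> \<le> g * \<phi> * K * K"
    proof (intro mult_left_mono)
      have "A2 \<subseteq> {v \<in> nbrs w. {w, v} \<in> visited m}" by (auto simp: A2_def visited_def nbrs_def)
      hence "card A2 \<le> card {v \<in> nbrs w. {w, v} \<in> visited m}"
        using finite_nbrs by (intro card_mono) auto
      also have "\<dots> \<le> card {e \<in> visited m. w \<in> e}" by (rule card_edges_at[OF finite_visited])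
      also have "\<dots> \<le> card (visited m)" by (intro card_mono finite_visited) auto
      finally show "real (card A2) \<le> K" using vis by (simp add: K_def)
    qed (use g \<phi> K in auto)
    finally show ?thesis by (simp add: power2_eq_square mult_ac)
  qed
  have "\<bar>walk_moment w0 (Suc l) m w\<bar> \<le> (\<Sum>v\<in>nbrs w. T v)"
    unfolding walk_moment_Suc T_def by (rule sum_abs)
  also have "\<dots> = (\<Sum>v\<in>A0. T v) + ((\<Sum>v\<in>A1. T v) + (\<Sum>v\<in>A2. T v))"
    unfolding split(1) using fins split(2,3) by (simp add: sum.union_disjoint)
  also have "\<dots> \<le> g * \<phi> * (p * c * (real D + 2 * K\<^sup>2)) + (g * \<phi> * (1 / c) + g * \<phi> * K\<^sup>2)"
    by (intro add_mono s0 s1 s2)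
  also have "\<dots> = growth c K ^ Suc l * \<phi>"
    by (simp add: growth_def g_def algebra_simps)
  finally show ?case by (simp add: K_def \<phi>_def)
qed

lemma expectation_mpow_le:
  assumes "c > 0" "l \<ge> 1" "w < n"
  shows "measure_pmf.expectation P (\<lambda>\<omega>. mpow n (X \<omega>) l w w) \<le> growth c (real l) ^ l"
proof -
  have "visited (\<lambda>_. 0) = {}" "once (\<lambda>_. 0) = {}" by (auto simp: visited_def once_def)
  moreover have "excess n {} w = 0" by (simp add: excess_def edge_degree_def)
  ultimately have "potential c (real l) (\<lambda>_. 0) w = 1" by (simp add: potential_def)
  with walk_moment_bound[of c l w "\<lambda>_. 0" l w] assms \<open>visited (\<lambda>_. 0) = {}\<close>
  show ?thesis by (simp add: walk_moment_def monomial_def)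
qed

text \<open>Markov's inequality for the trace. The factor \<open>n\<close> counts starting vertices
  and is later beaten by taking \<open>2 ^ t\<close> of order log n.\<close>

lemma prob_quad_form_le:
  assumes c: "c > 0" and \<rho>: "\<rho> > 0"
  shows "measure_pmf.prob P {\<omega>. \<not> (\<forall>x. \<bar>quad_form n (X \<omega>) x\<bar> \<le> \<rho> * (\<Sum>i<n. (x i)\<^sup>2))}
      \<le> real n * (growth c (2 * 2 ^ t) / \<rho>) ^ (2 * 2 ^ t)"
proof -
  define S where "S \<omega> = (\<Sum>i<n. \<Sum>j<n. (mpow n (X \<omega>) (2 ^ t) i j)\<^sup>2)" for \<omega>
  define l :: nat where "l = 2 * 2 ^ t"
  have l: "l \<ge> 1" by (simp add: l_def)
  have sym: "X \<omega> i j = X \<omega> j i" for \<omega> i j by (simp add: X_def insert_commute)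
  have S: "S \<omega> = (\<Sum>i<n. mpow n (X \<omega>) l i i)" for \<omega>
    unfolding S_def l_def by (rule mpow_frobenius[OF sym])
  have good: "\<forall>x. \<bar>quad_form n (X \<omega>) x\<bar> \<le> \<rho> * (\<Sum>i<n. (x i)\<^sup>2)" if "S \<omega> \<le> \<rho> ^ l" for \<omega>
    using quad_form_le_mpow[of n "X \<omega>" \<rho> t, OF sym] that \<rho> by (simp add: S_def l_def)
  have "measure_pmf.prob P {\<omega>. \<not> (\<forall>x. \<bar>quad_form n (X \<omega>) x\<bar> \<le> \<rho> * (\<Sum>i<n. (x i)\<^sup>2))}
     \<le> measure_pmf.prob P {\<omega>. S \<omega> \<ge> \<rho> ^ l}"
  proof (rule measure_pmf.finite_measure_mono)
    show "{\<omega>. \<not> (\<forall>x. \<bar>quad_form n (X \<omega>) x\<bar> \<le> \<rho> * (\<Sum>i<n. (x i)\<^sup>2))} \<subseteq> {\<omega>. S \<omega> \<ge> \<rho> ^ l}"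
      using good by (smt (verit) Collect_mono)
  qed simp
  also have "\<dots> \<le> measure_pmf.expectation P S / \<rho> ^ l"
    using \<rho> by (intro pmf_Markov_inequality fin) (auto simp: S_def sum_nonneg)
  also have "measure_pmf.expectation P S = (\<Sum>i<n. measure_pmf.expectation P (\<lambda>\<omega>. mpow n (X \<omega>) l i i))"
    unfolding S by simp
  also have "\<dots> / \<rho> ^ l \<le> (\<Sum>i<n. growth c (real l) ^ l) / \<rho> ^ l"
    using expectation_mpow_le[OF c l] \<rho> by (intro divide_right_mono sum_mono) auto
  also have "\<dots> = real n * (growth c (real l) / \<rho>) ^ l" by (simp add: power_divide)
  finally show ?thesis by (simp add: l_def)
qed

end

section \<open>Products of finitely supported distributions\<close>

lemma expectation_pair_pmf_mult:
  fixes g :: "'a \<Rightarrow> real" and h :: "'b \<Rightarrow> real"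
  assumes "finite (set_pmf A)" "finite (set_pmf B)"
  shows "measure_pmf.expectation (pair_pmf A B) (\<lambda>x. g (fst x) * h (snd x))
    = measure_pmf.expectation A g * measure_pmf.expectation B h"
proof -
  have "measure_pmf.expectation (pair_pmf A B) (\<lambda>x. g (fst x) * h (snd x))
    = (\<Sum>x\<in>set_pmf A \<times> set_pmf B. g (fst x) * h (snd x) * pmf (pair_pmf A B) x)"
    using assms by (intro integral_measure_pmf_real) auto
  also have "\<dots> = (\<Sum>a\<in>set_pmf A. \<Sum>b\<in>set_pmf B. (g a * pmf A a) * (h b * pmf B b))"
    by (simp add: sum.cartesian_product case_prod_unfold pmf_pair mult_ac)
       (metis (no_types, lifting) pmf_pair prod.collapse mult.assoc)
  also have "\<dots> = (\<Sum>a\<in>set_pmf A. g a * pmf A a) * (\<Sum>b\<in>set_pmf B. h b * pmf B b)"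
    by (simp add: sum_product)
  also have "(\<Sum>a\<in>set_pmf A. g a * pmf A a) = measure_pmf.expectation A g"
    using assms by (intro integral_measure_pmf_real[symmetric]) auto
  also have "(\<Sum>b\<in>set_pmf B. h b * pmf B b) = measure_pmf.expectation B h"
    using assms by (intro integral_measure_pmf_real[symmetric]) auto
  finally show ?thesis .
qed

lemma finite_set_Pi_pmf:
  assumes "finite A" "\<And>x. x \<in> A \<Longrightarrow> finite (set_pmf (p x))"
  shows "finite (set_pmf (Pi_pmf A dflt p))"
  using assms by (simp add: set_Pi_pmf finite_PiE_dflt)

lemma expectation_prod_Pi_pmf_finite:
  fixes f :: "'a \<Rightarrow> 'b \<Rightarrow> real"
  assumes "finite A" "\<And>x. x \<in> A \<Longrightarrow> finite (set_pmf (p x))"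
  shows "measure_pmf.expectation (Pi_pmf A dflt p) (\<lambda>y. \<Prod>x\<in>A. f x (y x)) =
           (\<Prod>x\<in>A. measure_pmf.expectation (p x) (f x))"
  using assms
proof (induction rule: finite_induct)
  case (insert x A)
  have "measure_pmf.expectation (Pi_pmf (insert x A) dflt p) (\<lambda>y. \<Prod>x\<in>insert x A. f x (y x))
     = measure_pmf.expectation (pair_pmf (p x) (Pi_pmf A dflt p))
         (\<lambda>z. f x (fst z) * (\<Prod>a\<in>A. f a (snd z a)))"
    using insert.hyps
    by (subst Pi_pmf_insert)
       (auto simp: case_prod_unfold intro!: Bochner_Integration.integral_cong prod.cong arg_cong2[of _ _ _ _ "(*)"])
  also have "\<dots> = measure_pmf.expectation (p x) (f x) *
      measure_pmf.expectation (Pi_pmf A dflt p) (\<lambda>y. \<Prod>a\<in>A. f a (y a))"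
    using insert by (intro expectation_pair_pmf_mult finite_set_Pi_pmf) auto
  finally show ?case using insert by simp
qed simp

text \<open>Dependence on a block of coordinates is expressed by invariance, so \<open>g\<close> and
  \<open>h\<close> can be functions of the whole configuration. The blocks used later are the
  columns of the biadjacency matrix.\<close>

lemma expectation_Pi_pmf_indep:
  fixes g h :: "('a \<Rightarrow> 'b) \<Rightarrow> real"
  assumes I: "finite I" "\<And>x. x \<in> I \<Longrightarrow> finite (set_pmf (p x))"
    and AI: "A \<subseteq> I"
    and g: "\<And>f f'. (\<And>x. x \<in> A \<Longrightarrow> f x = f' x) \<Longrightarrow> g f = g f'"
    and h: "\<And>f f'. (\<And>x. x \<notin> A \<Longrightarrow> f x = f' x) \<Longrightarrow> h f = h f'"
  shows "measure_pmf.expectation (Pi_pmf I dflt p) (\<lambda>f. g f * h f)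
    = measure_pmf.expectation (Pi_pmf I dflt p) g * measure_pmf.expectation (Pi_pmf I dflt p) h"
proof -
  have fin: "finite A" "finite (I - A)" using I AI by (auto intro: finite_subset)
  define U where "U = pair_pmf (Pi_pmf A dflt p) (Pi_pmf (I - A) dflt p)"
  define merge where "merge = (\<lambda>z x. if x \<in> A then fst z x else snd z x :: 'b)"
  have eq: "Pi_pmf I dflt p = map_pmf merge U"
    using Pi_pmf_union[of A "I - A" dflt p] fin AI
    by (simp add: U_def merge_def case_prod_unfold Un_absorb1)
  have gm: "g (merge z) = g (fst z)" and hm: "h (merge z) = h (snd z)" for z
    by (auto intro!: g h simp: merge_def)
  have f: "finite (set_pmf (Pi_pmf A dflt p))" "finite (set_pmf (Pi_pmf (I - A) dflt p))"
    using fin I AI by (auto intro!: finite_set_Pi_pmf)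
  have "measure_pmf.expectation (Pi_pmf I dflt p) (\<lambda>f. g f * h f)
     = measure_pmf.expectation U (\<lambda>z. g (fst z) * h (snd z))"
    unfolding eq by (simp add: gm hm)
  also have "\<dots> = measure_pmf.expectation (Pi_pmf A dflt p) g * measure_pmf.expectation (Pi_pmf (I - A) dflt p) h"
    unfolding U_def by (rule expectation_pair_pmf_mult[OF f])
  also have "measure_pmf.expectation (Pi_pmf A dflt p) g = measure_pmf.expectation (Pi_pmf I dflt p) g"
    unfolding eq by (simp add: gm U_def)
  also have "measure_pmf.expectation (Pi_pmf (I - A) dflt p) h = measure_pmf.expectation (Pi_pmf I dflt p) h"
    unfolding eq by (simp add: hm U_def)
  finally show ?thesis .
qed

section \<open>The random bipartite graph\<close>

text \<open>Together with \<open>bip_pmf\<close> this separates the coin flips from the edge set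
  built out of them, so that events can be analysed in the product space.\<close>

definition bip_edges :: "nat \<Rightarrow> nat \<Rightarrow> (nat \<times> nat \<Rightarrow> bool) \<Rightarrow> nat set set" where
  "bip_edges n1 n2 f = {{i, n1 + j} | i j. i < n1 \<and> j < n2 \<and> f (i, j)}"

definition bip_pmf :: "nat \<Rightarrow> nat \<Rightarrow> real \<Rightarrow> (nat \<times> nat \<Rightarrow> bool) pmf" where
  "bip_pmf n1 n2 p = Pi_pmf ({..<n1} \<times> {..<n2}) False (\<lambda>_. bernoulli_pmf p)"

lemma prob_random_bipartite:
  "measure_pmf.prob (random_bipartite n1 n2 p) {E. Q E}
     = measure_pmf.prob (bip_pmf n1 n2 p) {f. Q (bip_edges n1 n2 f)}"
  unfolding random_bipartite_def bip_pmf_def bip_edges_def by (simp add: vimage_def)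

lemma finite_bip_pmf: "finite (set_pmf (bip_pmf n1 n2 p))"
  unfolding bip_pmf_def by (rule finite_set_Pi_pmf) (auto intro: finite_subset[OF subset_UNIV])

lemma bip_edges_iff:
  "i < n1 \<Longrightarrow> j < n2 \<Longrightarrow> {i, n1 + j} \<in> bip_edges n1 n2 f \<longleftrightarrow> f (i, j)"
  by (auto simp: bip_edges_def doubleton_eq_iff)

lemma bip_edges_same_side:
  assumes "u < n1 \<longleftrightarrow> v < n1"
  shows "{u, v} \<notin> bip_edges n1 n2 f"
  using assms by (auto simp: bip_edges_def doubleton_eq_iff)

section \<open>Moments and norm of the centred adjacency matrix\<close>

definition centred :: "nat \<Rightarrow> nat \<Rightarrow> real \<Rightarrow> nat set \<Rightarrow> (nat \<times> nat \<Rightarrow> bool) \<Rightarrow> real" where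
  "centred n1 n2 p e f = of_bool (e \<in> bip_edges n1 n2 f) - p"

text \<open>The deviation is at most 1 in absolute value, so all absolute moments from the second on
  are at most the variance \<open>p * (1 - p)\<close>.\<close>

lemma bernoulli_central_moment:
  assumes "0 \<le> p" "p \<le> 1"
  shows "\<bar>measure_pmf.expectation (bernoulli_pmf p) (\<lambda>b. (of_bool b - p) ^ k)\<bar>
     \<le> (if k = 1 then 0 else if k > 0 then p else 1)"
proof -
  have E: "measure_pmf.expectation (bernoulli_pmf p) (\<lambda>b. (of_bool b - p) ^ k)
    = p * (1 - p) ^ k + (1 - p) * (- p) ^ k"
    using assms by simp
  consider "k = 0" | "k = 1" | "k \<ge> 2" by linarith
  thus ?thesis
  proof cases
    case 3
    have "\<bar>p * (1 - p) ^ k + (1 - p) * (- p) ^ k\<bar> \<le> p * (1 - p) ^ k + (1 - p) * p ^ k"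
      using assms by (intro order.trans[OF abs_triangle_ineq]) (auto simp: abs_mult power_abs)
    also have "\<dots> \<le> p * (1 - p) ^ 2 + (1 - p) * p ^ 2"
      using assms 3 by (intro add_mono mult_left_mono power_decreasing) auto
    also have "\<dots> = p * (1 - p)" by (simp add: power2_eq_square algebra_simps)
    also have "\<dots> \<le> p" using assms by (simp add: mult_left_le)
    finally show ?thesis using 3 E by simp
  next
    case 2
    thus ?thesis unfolding E by (simp add: algebra_simps)
  qed simp
qed

lemma bip_moments:
  fixes m :: "nat set \<Rightarrow> nat" and n1 n2 :: nat
  assumes p: "0 \<le> p" "p \<le> 1"
  defines "G \<equiv> bip_edges n1 n2 (\<lambda>_. True)"
  shows "\<bar>measure_pmf.expectation (bip_pmf n1 n2 p) (\<lambda>f. \<Prod>e\<in>G. centred n1 n2 p e f ^ m e)\<bar>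
          \<le> (if \<exists>e\<in>G. m e = 1 then 0 else p ^ card {e \<in> G. m e > 0})"
proof -
  define I where "I = {..<n1} \<times> {..<n2}"
  define ed where "ed = (\<lambda>ij. {fst ij, n1 + snd ij})"
  define M where "M k = measure_pmf.expectation (bernoulli_pmf p) (\<lambda>b. (of_bool b - p) ^ k)" for k
  have G: "G = ed ` I" by (auto simp: G_def bip_edges_def ed_def I_def image_iff Bex_def) blast+
  have inj: "inj_on ed I" by (auto simp: inj_on_def ed_def I_def doubleton_eq_iff)
  have finI: "finite I" by (simp add: I_def)
  have "(\<lambda>f. \<Prod>e\<in>G. centred n1 n2 p e f ^ m e) = (\<lambda>f. \<Prod>x\<in>I. (of_bool (f x) - p) ^ m (ed x))"
    unfolding G prod.reindex[OF inj]
    by (auto simp: centred_def ed_def I_def bip_edges_iff intro!: prod.cong)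
  hence "measure_pmf.expectation (bip_pmf n1 n2 p) (\<lambda>f. \<Prod>e\<in>G. centred n1 n2 p e f ^ m e)
     = (\<Prod>x\<in>I. M (m (ed x)))"
    unfolding M_def bip_pmf_def I_def[symmetric]
    by (simp only:) (rule expectation_prod_Pi_pmf_finite[OF finI], auto intro: finite_subset[OF subset_UNIV])
  also have "\<dots> = (\<Prod>e\<in>G. M (m e))" unfolding G by (simp add: prod.reindex[OF inj])
  finally have E: "\<bar>measure_pmf.expectation (bip_pmf n1 n2 p) (\<lambda>f. \<Prod>e\<in>G. centred n1 n2 p e f ^ m e)\<bar>
      = (\<Prod>e\<in>G. \<bar>M (m e)\<bar>)" by (simp add: abs_prod)
  have fG: "finite G" using finI by (simp add: G)
  show ?thesis
  proof (cases "\<exists>e\<in>G. m e = 1")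
    case True
    then obtain e where e: "e \<in> G" "m e = 1" by auto
    hence "M (m e) = 0" using bernoulli_central_moment[OF p, of 1] by (simp add: M_def)
    hence "(\<Prod>e\<in>G. \<bar>M (m e)\<bar>) = 0" using e fG by (intro prod_zero bexI[of _ e]) auto
    thus ?thesis using E True by simp
  next
    case False
    have "(\<Prod>e\<in>G. \<bar>M (m e)\<bar>) \<le> (\<Prod>e\<in>G. if m e > 0 then p else 1)"
    proof (rule prod_mono)
      fix e assume "e \<in> G"
      thus "0 \<le> \<bar>M (m e)\<bar> \<and> \<bar>M (m e)\<bar> \<le> (if m e > 0 then p else 1)"
        using bernoulli_central_moment[OF p, of "m e"] False by (simp add: M_def)
    qed
    also have "\<dots> = p ^ card {e \<in> G. m e > 0}"
      using fG by (simp add: prod.If_cases Int_def)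
    finally show ?thesis using False E by simp
  qed
qed

lemma sum_add_split: "(\<Sum>i<n1 + n2. g i) = (\<Sum>i<n1. g i) + (\<Sum>j<n2. g (n1 + j))"
  for g :: "nat \<Rightarrow> 'a::comm_monoid_add"
  by (metis (no_types, lifting) atLeast0LessThan sum.atLeastLessThan_concat sum.shift_bounds_nat_ivl add_0 le_add1 le0 add.commute sum.cong)

lemma quad_form_bipartite:
  assumes same: "\<And>u v. (u < n1 \<longleftrightarrow> v < n1) \<Longrightarrow> a u v = 0" and sym: "\<And>u v. a u v = a v u"
  shows "quad_form (n1 + n2) a x = 2 * (\<Sum>i<n1. \<Sum>j<n2. a i (n1 + j) * x i * x (n1 + j))"
proof -
  have "quad_form (n1 + n2) a x = (\<Sum>i<n1. \<Sum>j<n2. a i (n1 + j) * x i * x (n1 + j))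
     + (\<Sum>j<n2. \<Sum>i<n1. a (n1 + j) i * x (n1 + j) * x i)"
    unfolding quad_form_def sum_add_split by (simp add: same)
  also have "(\<Sum>j<n2. \<Sum>i<n1. a (n1 + j) i * x (n1 + j) * x i)
     = (\<Sum>i<n1. \<Sum>j<n2. a i (n1 + j) * x i * x (n1 + j))"
    by (subst sum.swap) (auto intro!: sum.cong simp: mult_ac sym[of "n1 + _"])
  finally show ?thesis by simp
qed

text \<open>\<open>\<rho>\<close> bounds the operator norm of the symmetric matrix whose two
  off-diagonal blocks are the centred biadjacency matrix and its transpose; both blocks together
  give the factor 2. Separate vectors \<open>x\<close> and \<open>y\<close> make it easy to rescale
  each side.\<close>

definition bip_norm_le :: "nat \<Rightarrow> nat \<Rightarrow> real \<Rightarrow> real \<Rightarrow> (nat \<times> nat \<Rightarrow> bool) \<Rightarrow> bool" where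
  "bip_norm_le n1 n2 p \<rho> f \<longleftrightarrow> (\<forall>x y. \<bar>2 * (\<Sum>i<n1. \<Sum>j<n2. (of_bool (f (i, j)) - p) * x i * y j)\<bar>
     \<le> \<rho> * ((\<Sum>i<n1. (x i)\<^sup>2) + (\<Sum>j<n2. (y j)\<^sup>2)))"

text \<open>The degree bound is \<open>D = n2\<close> for both sides, although a vertex of V2 has
  only n1 potential neighbours; the constant in the theorem leaves room for this.\<close>

lemma prob_bip_norm:
  assumes n: "n1 \<le> n2" and p: "0 \<le> p" "p \<le> 1" and c: "c > 0" and \<rho>: "\<rho> > 0"
  shows "measure_pmf.prob (bip_pmf n1 n2 p) {f. \<not> bip_norm_le n1 n2 p \<rho> f}
    \<le> real (n1 + n2) * ((p * c * (real n2 + 2 * (2 * 2 ^ t)\<^sup>2) + 1 / c + (2 * 2 ^ t)\<^sup>2) / \<rho>) ^ (2 * 2 ^ t)"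
proof -
  define G where "G = bip_edges n1 n2 (\<lambda>_. True)"
  interpret random_symmetric_matrix "bip_pmf n1 n2 p" "centred n1 n2 p" G "n1 + n2" n2 p
  proof
    fix e assume "e \<in> G"
    thus "\<exists>u v. e = {u, v} \<and> u \<noteq> v \<and> u < n1 + n2 \<and> v < n1 + n2"
      by (fastforce simp: G_def bip_edges_def)
  next
    fix u
    show "card {v. {u, v} \<in> G} \<le> n2"
    proof (cases "u < n1")
      case True
      have "{v. {u, v} \<in> G} \<subseteq> {n1..<n1 + n2}"
        using True by (auto simp: G_def bip_edges_def doubleton_eq_iff)
      from card_mono[OF _ this] show ?thesis by simp
    next
      case False
      have "{v. {u, v} \<in> G} \<subseteq> {..<n1}"
        using False by (auto simp: G_def bip_edges_def doubleton_eq_iff)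
      from card_mono[OF _ this] show ?thesis using n by simp
    qed
  next
    fix m :: "nat set \<Rightarrow> nat"
    show "\<bar>measure_pmf.expectation (bip_pmf n1 n2 p) (\<lambda>f. \<Prod>e\<in>G. centred n1 n2 p e f ^ m e)\<bar>
          \<le> (if \<exists>e\<in>G. m e = 1 then 0 else p ^ card {e \<in> G. m e > 0})"
      unfolding G_def by (rule bip_moments[OF p])
  qed (use finite_bip_pmf p in auto)
  have X: "X f u v = (if {u, v} \<in> bip_edges n1 n2 (\<lambda>_. True) then centred n1 n2 p {u, v} f else 0)" for f u v
    by (subst X_def) (simp add: G_def)
  have qf: "quad_form (n1 + n2) (X f) x
     = 2 * (\<Sum>i<n1. \<Sum>j<n2. (of_bool (f (i, j)) - p) * x i * x (n1 + j))" for f x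
  proof -
    have "quad_form (n1 + n2) (X f) x = 2 * (\<Sum>i<n1. \<Sum>j<n2. X f i (n1 + j) * x i * x (n1 + j))"
      by (rule quad_form_bipartite) (auto simp: X bip_edges_same_side insert_commute)
    thus ?thesis by (simp add: X bip_edges_iff centred_def)
  qed
  have "bip_norm_le n1 n2 p \<rho> f"
    if f: "\<forall>x. \<bar>quad_form (n1 + n2) (X f) x\<bar> \<le> \<rho> * (\<Sum>i<n1 + n2. (x i)\<^sup>2)" for f
    unfolding bip_norm_le_def
  proof (intro allI)
    fix x y :: "nat \<Rightarrow> real"
    show "\<bar>2 * (\<Sum>i<n1. \<Sum>j<n2. (of_bool (f (i, j)) - p) * x i * y j)\<bar>
     \<le> \<rho> * ((\<Sum>i<n1. (x i)\<^sup>2) + (\<Sum>j<n2. (y j)\<^sup>2))"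
      using f[rule_format, of "\<lambda>i. if i < n1 then x i else y (i - n1)"] unfolding qf sum_add_split by simp
  qed
  hence "measure_pmf.prob (bip_pmf n1 n2 p) {f. \<not> bip_norm_le n1 n2 p \<rho> f} \<le>
     measure_pmf.prob (bip_pmf n1 n2 p) {f. \<not> (\<forall>x. \<bar>quad_form (n1 + n2) (X f) x\<bar> \<le> \<rho> * (\<Sum>i<n1 + n2. (x i)\<^sup>2))}"
    by (intro measure_pmf.finite_measure_mono) auto
  also have "\<dots> \<le> real (n1 + n2) * (growth c (2 * 2 ^ t) / \<rho>) ^ (2 * 2 ^ t)"
    by (rule prob_quad_form_le[OF c \<rho>])
  finally show ?thesis by (simp add: growth_def)
qed

section \<open>Eigenvalue bounds from bounds on bilinear forms\<close>

lemma adjacency_quad_form: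
  "quad_form (n1 + n2) (\<lambda>u v. of_bool ({u, v} \<in> bip_edges n1 n2 f)) x
     = 2 * (\<Sum>i<n1. \<Sum>j<n2. of_bool (f (i, j)) * x i * x (n1 + j))"
proof -
  have "quad_form (n1 + n2) (\<lambda>u v. of_bool ({u, v} \<in> bip_edges n1 n2 f)) x
     = 2 * (\<Sum>i<n1. \<Sum>j<n2. of_bool ({i, n1 + j} \<in> bip_edges n1 n2 f) * x i * x (n1 + j))"
    by (rule quad_form_bipartite) (auto simp: bip_edges_same_side insert_commute)
  thus ?thesis by (simp add: bip_edges_iff)
qed

lemma quad_form_cong:
  assumes "\<And>i j. i < n \<Longrightarrow> j < n \<Longrightarrow> a i j = b i j"
  shows "quad_form n a x = quad_form n b x"
  unfolding quad_form_def using assms by (auto intro!: sum.cong)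

lemma mu_adjacency_le:
  assumes "n1 + n2 \<ge> 3" and norm: "bip_norm_le n1 n2 p \<rho> f"
  shows "mu 2 (adjacency_matrix (n1 + n2) (bip_edges n1 n2 f)) \<le> \<rho>"
proof -
  define E where "E = bip_edges n1 n2 f"
  define A where "A = adjacency_matrix (n1 + n2) E"
  have A: "A \<in> carrier_mat (n1 + n2) (n1 + n2)" by (simp add: A_def adjacency_matrix_def)
  have sym: "transpose_mat A = A"
    unfolding A_def adjacency_matrix_def by (intro eq_matI) (auto simp: insert_commute)
  have "\<bar>mu 2 A - 0\<bar> \<le> \<rho>"
  proof (rule mu_near[OF A sym])
    fix x :: "nat \<Rightarrow> real"
    have "quad_form (n1 + n2) (\<lambda>i j. A $$ (i, j)) x = quad_form (n1 + n2) (\<lambda>u v. of_bool ({u, v} \<in> E)) x"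
      by (rule quad_form_cong) (simp add: A_def adjacency_matrix_def)
    also have "\<dots> = 2 * (\<Sum>i<n1. \<Sum>j<n2. of_bool (f (i, j)) * x i * x (n1 + j))"
      unfolding E_def by (rule adjacency_quad_form)
    \<comment> \<open>The mean matrix has all entries between the sides equal to \<open>p\<close>,
      so its form is a product of two linear forms: \<open>a\<close> is \<open>p\<close> on V1 and
      \<open>b\<close> is 1 on V2.\<close>
    also have "\<dots> = 2 * (\<Sum>i<n1. \<Sum>j<n2. (of_bool (f (i, j)) - p) * x i * x (n1 + j))
       + 2 * (\<Sum>i<n1. p * x i) * (\<Sum>j<n2. x (n1 + j))"
      by (simp add: algebra_simps sum_distrib_left sum_distrib_right sum_subtractf sum_product)
    finally have "quad_form (n1 + n2) (\<lambda>i j. A $$ (i, j)) x - 2 * (\<Sum>i<n1. p * x i) * (\<Sum>j<n2. x (n1 + j))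
       = 2 * (\<Sum>i<n1. \<Sum>j<n2. (of_bool (f (i, j)) - p) * x i * x (n1 + j))" by simp
    moreover have "(\<Sum>i<n1 + n2. (if i < n1 then p else 0) * x i) = (\<Sum>i<n1. p * x i)"
      "(\<Sum>i<n1 + n2. (if i < n1 then 0 else 1) * x i) = (\<Sum>j<n2. x (n1 + j))"
      unfolding sum_add_split by simp_all
    ultimately show "\<bar>quad_form (n1 + n2) (\<lambda>i j. A $$ (i, j)) x - 0 * (\<Sum>i<n1 + n2. (x i)\<^sup>2)
         - 2 * (\<Sum>i<n1 + n2. (if i < n1 then p else 0) * x i) * (\<Sum>i<n1 + n2. (if i < n1 then 0 else 1) * x i)\<bar>
       \<le> \<rho> * (\<Sum>i<n1 + n2. (x i)\<^sup>2)"
      using norm[unfolded bip_norm_le_def, rule_format, of x "\<lambda>j. x (n1 + j)"]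
      by (simp add: sum_add_split)
  qed (use assms in auto)
  thus ?thesis by (simp add: A_def E_def)
qed

definition deg1 :: "nat \<Rightarrow> (nat \<times> nat \<Rightarrow> bool) \<Rightarrow> nat \<Rightarrow> real" where
  "deg1 n2 f i = (\<Sum>j<n2. of_bool (f (i, j)))"

definition deg2 :: "nat \<Rightarrow> (nat \<times> nat \<Rightarrow> bool) \<Rightarrow> nat \<Rightarrow> real" where
  "deg2 n1 f j = (\<Sum>i<n1. of_bool (f (i, j)))"

lemma vertex_degree_left:
  assumes "i < n1"
  shows "real (vertex_degree (bip_edges n1 n2 f) i) = deg1 n2 f i"
proof -
  have "{e \<in> bip_edges n1 n2 f. i \<in> e} = (\<lambda>j. {i, n1 + j}) ` {j \<in> {..<n2}. f (i, j)}"
    using assms by (auto simp: bip_edges_def)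
  moreover have "inj_on (\<lambda>j. {i, n1 + j}) {j \<in> {..<n2}. f (i, j)}"
    by (auto simp: inj_on_def doubleton_eq_iff)
  ultimately show ?thesis
    by (simp add: vertex_degree_def card_image deg1_def sum_of_bool_eq Int_def)
qed

lemma vertex_degree_right:
  assumes "j < n2"
  shows "real (vertex_degree (bip_edges n1 n2 f) (n1 + j)) = deg2 n1 f j"
proof -
  have "{e \<in> bip_edges n1 n2 f. n1 + j \<in> e} = (\<lambda>i. {i, n1 + j}) ` {i \<in> {..<n1}. f (i, j)}"
    using assms by (auto simp: bip_edges_def)
  moreover have "inj_on (\<lambda>i. {i, n1 + j}) {i \<in> {..<n1}. f (i, j)}"
    by (auto simp: inj_on_def doubleton_eq_iff)
  ultimately show ?thesis
    by (simp add: vertex_degree_def card_image deg2_def sum_of_bool_eq Int_def)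
qed

text \<open>\<open>a\<close> and \<open>b\<close> stay free because the two regimes remove different
  rank-two terms. Isolated vertices are covered: division by \<open>sqrt 0\<close> gives 0 here just
  as in \<open>inv_sqrt_degree_matrix\<close>.\<close>

lemma mu_graph_near:
  assumes i: "1 < k" "k < n1 + n2"
    and form: "\<And>x y. \<bar>2 * (\<Sum>i<n1. \<Sum>j<n2. of_bool (f (i, j)) * (x i / sqrt (deg1 n2 f i)) * (y j / sqrt (deg2 n1 f j)))
        - 2 * (\<Sum>i<n1. a i * x i) * (\<Sum>j<n2. b j * y j)\<bar>
        \<le> \<beta> * ((\<Sum>i<n1. (x i)\<^sup>2) + (\<Sum>j<n2. (y j)\<^sup>2))"
  shows "\<bar>mu_graph k (n1 + n2) (bip_edges n1 n2 f) - 1\<bar> \<le> \<beta>"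
proof -
  define N where "N = n1 + n2"
  define E where "E = bip_edges n1 n2 f"
  define M where "M = normalized_laplacian N E"
  define s where "s v = 1 / sqrt (real (vertex_degree E v))" for v
  have M: "M \<in> carrier_mat N N"
    unfolding M_def normalized_laplacian_def inv_sqrt_degree_matrix_def adjacency_matrix_def
    by (intro minus_carrier_mat mult_carrier_mat) auto
  have ent: "M $$ (u, v) = of_bool (u = v) - of_bool ({u, v} \<in> E) * s u * s v" if "u < N" "v < N" for u v
  proof -
    have "mat_diag N s * adjacency_matrix N E = Matrix.mat N N (\<lambda>(i, j). s i * adjacency_matrix N E $$ (i, j))"
      by (rule mat_diag_mult_left) (simp add: adjacency_matrix_def)
    moreover have "\<dots> * mat_diag N s = Matrix.mat N N (\<lambda>(i, j). \<dots> $$ (i, j) * s j)"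
      by (rule mat_diag_mult_right) simp
    moreover have "inv_sqrt_degree_matrix N E = mat_diag N s"
      unfolding inv_sqrt_degree_matrix_def s_def ..
    ultimately have "(inv_sqrt_degree_matrix N E * adjacency_matrix N E * inv_sqrt_degree_matrix N E) $$ (u, v)
      = s u * of_bool ({u, v} \<in> E) * s v"
      using that by (simp add: adjacency_matrix_def)
    moreover have "dim_row (inv_sqrt_degree_matrix N E) = N" "dim_col (inv_sqrt_degree_matrix N E) = N"
      unfolding inv_sqrt_degree_matrix_def using mat_diag_dim by (metis carrier_matD)+
    ultimately show ?thesis using that
      by (simp add: M_def normalized_laplacian_def)
  qed
  have sym: "transpose_mat M = M"
    using M by (intro eq_matI) (auto simp: ent insert_commute mult_ac)
  have "\<bar>mu k M - 1\<bar> \<le> \<beta>"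
  proof (rule mu_near[OF M sym])
    fix x :: "nat \<Rightarrow> real"
    have "quad_form N (\<lambda>i j. M $$ (i, j)) x
       = quad_form N (\<lambda>u v. of_bool (u = v) - of_bool ({u, v} \<in> E) * s u * s v) x"
      by (rule quad_form_cong) (simp add: ent)
    also have "\<dots> = (\<Sum>u<N. \<Sum>v<N. of_bool (u = v) * x u * x v) - quad_form N (\<lambda>u v. of_bool ({u, v} \<in> E)) (\<lambda>v. s v * x v)"
      by (simp add: quad_form_def algebra_simps sum_subtractf)
    also have "(\<Sum>u<N. \<Sum>v<N. of_bool (u = v) * x u * x v) = (\<Sum>u<N. (x u)\<^sup>2)"
      by (intro sum.cong) (auto simp: of_bool_def if_distrib[of "\<lambda>z. z * _"] sum.delta power2_eq_square cong: if_cong)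
    also have "quad_form N (\<lambda>u v. of_bool ({u, v} \<in> E)) (\<lambda>v. s v * x v)
       = 2 * (\<Sum>i<n1. \<Sum>j<n2. of_bool (f (i, j)) * (s i * x i) * (s (n1 + j) * x (n1 + j)))"
      unfolding E_def N_def by (rule adjacency_quad_form)
    also have "\<dots> = 2 * (\<Sum>i<n1. \<Sum>j<n2. of_bool (f (i, j)) * (x i / sqrt (deg1 n2 f i)) * (x (n1 + j) / sqrt (deg2 n1 f j)))"
      by (intro arg_cong[of _ _ "\<lambda>z. 2 * z"] sum.cong refl)
         (simp add: s_def E_def vertex_degree_left vertex_degree_right)
    finally have "quad_form N (\<lambda>i j. M $$ (i, j)) x - 1 * (\<Sum>u<N. (x u)\<^sup>2) =
      - (2 * (\<Sum>i<n1. \<Sum>j<n2. of_bool (f (i, j)) * (x i / sqrt (deg1 n2 f i)) * (x (n1 + j) / sqrt (deg2 n1 f j))))"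
      by simp
    moreover have "(\<Sum>i<N. (if i < n1 then - a i else 0) * x i) = - (\<Sum>i<n1. a i * x i)"
      "(\<Sum>i<N. (if i < n1 then 0 else b (i - n1)) * x i) = (\<Sum>j<n2. b j * x (n1 + j))"
      unfolding N_def sum_add_split by (simp_all add: sum_negf)
    ultimately show "\<bar>quad_form N (\<lambda>i j. M $$ (i, j)) x - 1 * (\<Sum>i<N. (x i)\<^sup>2)
         - 2 * (\<Sum>i<N. (if i < n1 then - a i else 0) * x i) * (\<Sum>i<N. (if i < n1 then 0 else b (i - n1)) * x i)\<bar>
       \<le> \<beta> * (\<Sum>i<N. (x i)\<^sup>2)"
      using form[of x "\<lambda>j. x (n1 + j)"] by (simp add: N_def sum_add_split)
  qed (use i in \<open>auto simp: N_def\<close>)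
  thus ?thesis by (simp add: mu_graph_def M_def N_def E_def)
qed

text \<open>The rank-two term subtracts \<open>p\<close> from every entry, which leaves the centred
  matrix acting on the vectors divided by root degrees. Multiplied by \<open>sqrt \<delta>1\<close>
  and \<open>sqrt \<delta>2\<close>, these vectors are no longer than \<open>x\<close> and
  \<open>y\<close>.\<close>

lemma mu_graph_near_of_degrees:
  assumes k: "1 < k" "k < n1 + n2" and norm: "bip_norm_le n1 n2 p \<rho> f" and \<rho>: "\<rho> \<ge> 0"
    and d1: "\<And>i. i < n1 \<Longrightarrow> deg1 n2 f i \<ge> \<delta>1" "\<delta>1 > 0"
    and d2: "\<And>j. j < n2 \<Longrightarrow> deg2 n1 f j \<ge> \<delta>2" "\<delta>2 > 0"
  shows "\<bar>mu_graph k (n1 + n2) (bip_edges n1 n2 f) - 1\<bar> \<le> \<rho> / sqrt (\<delta>1 * \<delta>2)"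
proof (rule mu_graph_near[OF k, where a = "\<lambda>i. p / sqrt (deg1 n2 f i)" and b = "\<lambda>j. 1 / sqrt (deg2 n1 f j)"])
  fix x y :: "nat \<Rightarrow> real"
  define r where "r i = sqrt (deg1 n2 f i)" for i
  define s where "s j = sqrt (deg2 n1 f j)" for j
  define x' where "x' i = sqrt \<delta>1 * (x i / r i)" for i
  define y' where "y' j = sqrt \<delta>2 * (y j / s j)" for j
  have x': "(x' i)\<^sup>2 \<le> (x i)\<^sup>2" if "i < n1" for i
    using d1(1)[OF that] d1(2)
    by (auto simp: x'_def r_def power_mult_distrib power_divide divide_le_eq mult_right_mono mult.commute)
  have y': "(y' j)\<^sup>2 \<le> (y j)\<^sup>2" if "j < n2" for j
    using d2(1)[OF that] d2(2)
    by (auto simp: y'_def s_def power_mult_distrib power_divide divide_le_eq mult_right_mono mult.commute)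
  define S where "S = 2 * (\<Sum>i<n1. \<Sum>j<n2. of_bool (f (i, j)) * (x i / r i) * (y j / s j))
      - 2 * (\<Sum>i<n1. p / r i * x i) * (\<Sum>j<n2. 1 / s j * y j)"
  have "S = 2 * (\<Sum>i<n1. \<Sum>j<n2. (of_bool (f (i, j)) - p) * (x i / r i) * (y j / s j))"
  proof -
    have "(\<Sum>i<n1. p / r i * x i) * (\<Sum>j<n2. 1 / s j * y j) = (\<Sum>i<n1. \<Sum>j<n2. p * (x i / r i) * (y j / s j))"
      unfolding sum_product by (intro sum.cong refl) simp
    thus ?thesis unfolding S_def mult.assoc[of 2] by (simp only: left_diff_distrib sum_subtractf right_diff_distrib)
  qed
  hence S: "sqrt (\<delta>1 * \<delta>2) * S = 2 * (sqrt (\<delta>1 * \<delta>2) * (\<Sum>i<n1. \<Sum>j<n2. (of_bool (f (i, j)) - p) * (x i / r i) * (y j / s j)))"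
    by (simp only: mult.left_commute)
  have "sqrt (\<delta>1 * \<delta>2) * S = 2 * (\<Sum>i<n1. \<Sum>j<n2. (of_bool (f (i, j)) - p) * x' i * y' j)"
    unfolding S unfolding sum_distrib_left x'_def y'_def real_sqrt_mult
    by (intro sum.cong refl) (simp only: mult_ac)
  hence "\<bar>sqrt (\<delta>1 * \<delta>2) * S\<bar> \<le> \<rho> * ((\<Sum>i<n1. (x' i)\<^sup>2) + (\<Sum>j<n2. (y' j)\<^sup>2))"
    using norm[unfolded bip_norm_le_def, rule_format, of x' y'] by (simp only:)
  also have "\<dots> \<le> \<rho> * ((\<Sum>i<n1. (x i)\<^sup>2) + (\<Sum>j<n2. (y j)\<^sup>2))"
    using \<rho> x' y' by (intro mult_left_mono add_mono sum_mono) auto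
  finally have "sqrt (\<delta>1 * \<delta>2) * \<bar>S\<bar> \<le> \<rho> * ((\<Sum>i<n1. (x i)\<^sup>2) + (\<Sum>j<n2. (y j)\<^sup>2))"
    using d1(2) d2(2) by (simp add: abs_mult)
  hence "\<bar>S\<bar> \<le> \<rho> * ((\<Sum>i<n1. (x i)\<^sup>2) + (\<Sum>j<n2. (y j)\<^sup>2)) / sqrt (\<delta>1 * \<delta>2)"
    using d1(2) d2(2) by (subst pos_le_divide_eq) (auto simp: mult.commute)
  hence "\<bar>S\<bar> \<le> \<rho> / sqrt (\<delta>1 * \<delta>2) * ((\<Sum>i<n1. (x i)\<^sup>2) + (\<Sum>j<n2. (y j)\<^sup>2))"
    unfolding times_divide_eq_left .
  thus "\<bar>2 * (\<Sum>i<n1. \<Sum>j<n2. of_bool (f (i, j)) * (x i / sqrt (deg1 n2 f i)) * (y j / sqrt (deg2 n1 f j)))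
        - 2 * (\<Sum>i<n1. p / sqrt (deg1 n2 f i) * x i) * (\<Sum>j<n2. 1 / sqrt (deg2 n1 f j) * y j)\<bar>
        \<le> \<rho> / sqrt (\<delta>1 * \<delta>2) * ((\<Sum>i<n1. (x i)\<^sup>2) + (\<Sum>j<n2. (y j)\<^sup>2))"
    unfolding S_def r_def s_def .
qed

lemma sum_square_centred_le:
  fixes u :: "nat \<Rightarrow> real"
  assumes "n > 0"
  shows "(\<Sum>i<n. (u i - (\<Sum>i<n. u i) / n)\<^sup>2) \<le> (\<Sum>i<n. (u i)\<^sup>2)"
proof -
  define c where "c = (\<Sum>i<n. u i) / n"
  have c: "(\<Sum>i<n. u i) = n * c" using assms by (simp add: c_def)
  have "(\<Sum>i<n. (u i - c)\<^sup>2) = (\<Sum>i<n. (u i)\<^sup>2) - 2 * c * (\<Sum>i<n. u i) + n * c\<^sup>2"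
    by (simp add: power2_diff sum.distrib sum_subtractf sum_distrib_left mult_ac)
  also have "\<dots> = (\<Sum>i<n. (u i)\<^sup>2) - n * c\<^sup>2" unfolding c by (simp add: power2_eq_square)
  also have "\<dots> \<le> (\<Sum>i<n. (u i)\<^sup>2)" by simp
  finally show ?thesis by (simp add: c_def)
qed

lemma deg2_nonneg: "deg2 n1 f j \<ge> 0" by (simp add: deg2_def)

text \<open>Singular values of the normalised biadjacency matrix are square roots of two-step
  eigenvalues, whence the square root in the bound. Subtracting the mean of \<open>u\<close> makes
  \<open>two\<close> applicable, and the subtracted part is exactly the rank-two term. Degrees are
  bounded below on V1 alone, so V2 may have isolated vertices.\<close>

lemma mu_graph_near_of_two_step:
  assumes n1: "n1 > 0" and k: "1 < k" "k < n1 + n2" and \<kappa>: "\<kappa> > 0"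
    and d1: "\<And>i. i < n1 \<Longrightarrow> deg1 n2 f i \<ge> \<delta>" "\<delta> > 0"
    and two: "\<And>z. (\<Sum>i<n1. z i) = 0 \<Longrightarrow>
       (\<Sum>j<n2. (\<Sum>i<n1. of_bool (f (i, j)) * z i)\<^sup>2 / deg2 n1 f j) \<le> \<kappa> * (\<Sum>i<n1. (z i)\<^sup>2)"
  shows "\<bar>mu_graph k (n1 + n2) (bip_edges n1 n2 f) - 1\<bar> \<le> sqrt (\<kappa> / \<delta>)"
proof (rule mu_graph_near[OF k, where a = "\<lambda>i. 1 / (real n1 * sqrt (deg1 n2 f i))" and b = "\<lambda>j. sqrt (deg2 n1 f j)"])
  fix x y :: "nat \<Rightarrow> real"
  define r where "r i = sqrt (deg1 n2 f i)" for i
  define s where "s j = sqrt (deg2 n1 f j)" for j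
  define \<beta> where "\<beta> = sqrt (\<kappa> / \<delta>)"
  have \<beta>: "\<beta> > 0" "\<beta>\<^sup>2 = \<kappa> / \<delta>" using \<kappa> d1(2) by (auto simp: \<beta>_def)
  define u where "u i = x i / r i" for i
  define c where "c = (\<Sum>i<n1. u i) / n1"
  define z where "z i = u i - c" for i
  have z0: "(\<Sum>i<n1. z i) = 0" using n1 by (simp add: z_def sum_subtractf c_def)
  define h where "h j = (\<Sum>i<n1. of_bool (f (i, j)) * z i) / s j" for j
  have c: "(\<Sum>i<n1. 1 / (n1 * r i) * x i) = c"
    by (simp add: c_def u_def sum_divide_distrib mult.commute)
  \<comment> \<open>Holds at isolated vertices as well, where both sides are 0.\<close>
  have ss: "deg2 n1 f j / s j = s j" for j
    by (simp add: s_def real_div_sqrt deg2_nonneg)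
  have "(\<Sum>i<n1. \<Sum>j<n2. of_bool (f (i, j)) * u i * (y j / s j))
      = (\<Sum>j<n2. \<Sum>i<n1. of_bool (f (i, j)) * (z i + c) * (y j / s j))"
    unfolding z_def diff_add_cancel by (rule sum.swap)
  also have "\<dots> = (\<Sum>j<n2. y j * h j + c * (deg2 n1 f j / s j) * y j)"
  proof (intro sum.cong refl)
    fix j
    define A where "A = (\<Sum>i<n1. of_bool (f (i, j)) * z i)"
    define B where "B = deg2 n1 f j"
    have "(\<Sum>i<n1. of_bool (f (i, j)) * (z i + c)) = A + B * c"
      unfolding A_def B_def deg2_def distrib_left sum.distrib sum_distrib_right ..
    hence "(\<Sum>i<n1. of_bool (f (i, j)) * (z i + c) * (y j / s j)) = (A + B * c) * (y j / s j)"
      by (simp only: flip: sum_distrib_right)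
    also have "\<dots> = y j * (A / s j) + c * (B / s j) * y j" by (simp add: algebra_simps add_divide_distrib)
    finally show "(\<Sum>i<n1. of_bool (f (i, j)) * (z i + c) * (y j / s j)) = y j * h j + c * (deg2 n1 f j / s j) * y j"
      by (simp only: h_def A_def B_def)
  qed
  also have "\<dots> = (\<Sum>j<n2. y j * h j) + c * (\<Sum>j<n2. s j * y j)"
    unfolding ss by (simp add: sum.distrib sum_distrib_left mult_ac)
  finally have V: "(\<Sum>i<n1. \<Sum>j<n2. of_bool (f (i, j)) * u i * (y j / s j))
      = (\<Sum>j<n2. y j * h j) + c * (\<Sum>j<n2. s j * y j)" .
  have "(\<Sum>j<n2. 2 * y j * h j) = 2 * (\<Sum>j<n2. y j * h j)"
    by (simp only: sum_distrib_left mult.assoc)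
  hence eq: "2 * (\<Sum>i<n1. \<Sum>j<n2. of_bool (f (i, j)) * u i * (y j / s j))
        - 2 * (\<Sum>i<n1. 1 / (n1 * r i) * x i) * (\<Sum>j<n2. s j * y j) = (\<Sum>j<n2. 2 * y j * h j)"
    unfolding c V by (simp only: distrib_left add_diff_cancel_right' mult.assoc)
  have "(\<Sum>j<n2. (h j)\<^sup>2) = (\<Sum>j<n2. (\<Sum>i<n1. of_bool (f (i, j)) * z i)\<^sup>2 / deg2 n1 f j)"
    unfolding h_def s_def power_divide using deg2_nonneg by simp
  also have "\<dots> \<le> \<kappa> * (\<Sum>i<n1. (z i)\<^sup>2)" by (rule two[OF z0])
  also have "\<dots> \<le> \<kappa> * (\<Sum>i<n1. (u i)\<^sup>2)"
    using \<kappa> sum_square_centred_le[OF n1, of u] unfolding z_def c_def by (intro mult_left_mono) auto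
  also have "\<dots> \<le> \<kappa> * (\<Sum>i<n1. (x i)\<^sup>2 / \<delta>)"
  proof (intro mult_left_mono sum_mono)
    fix i assume "i \<in> {..<n1}"
    hence d: "deg1 n2 f i \<ge> \<delta>" using d1 by simp
    hence "(u i)\<^sup>2 = (x i)\<^sup>2 / deg1 n2 f i" using d1(2) by (simp add: u_def r_def power_divide)
    also have "\<dots> \<le> (x i)\<^sup>2 / \<delta>" using d d1(2) by (intro divide_left_mono) auto
    finally show "(u i)\<^sup>2 \<le> (x i)\<^sup>2 / \<delta>" .
  qed (use \<kappa> in simp)
  also have "\<dots> = \<beta>\<^sup>2 * (\<Sum>i<n1. (x i)\<^sup>2)" unfolding \<beta>(2) by (simp flip: sum_divide_distrib)
  finally have h2: "(\<Sum>j<n2. (h j)\<^sup>2) \<le> \<beta>\<^sup>2 * (\<Sum>i<n1. (x i)\<^sup>2)" .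
  \<comment> \<open>The weight \<open>\<beta>\<close> balances the two parts: by \<open>h2\<close>,
    the squares of \<open>h\<close> sum to at most \<open>\<beta>\<^sup>2\<close> times those of
    \<open>x\<close>, so \<open>x\<close> and \<open>y\<close> end with the same
    coefficient.\<close>
  have amgm: "\<bar>2 * y j * h j\<bar> \<le> \<beta> * (y j)\<^sup>2 + (h j)\<^sup>2 / \<beta>" for j
  proof -
    have "0 \<le> (\<beta> * \<bar>y j\<bar> - \<bar>h j\<bar>)\<^sup>2" by simp
    hence "2 * \<beta> * \<bar>y j\<bar> * \<bar>h j\<bar> \<le> \<beta>\<^sup>2 * (y j)\<^sup>2 + (h j)\<^sup>2"
      by (simp add: power2_diff power_mult_distrib mult_ac)
    hence "2 * \<beta> * \<bar>y j\<bar> * \<bar>h j\<bar> / \<beta> \<le> (\<beta>\<^sup>2 * (y j)\<^sup>2 + (h j)\<^sup>2) / \<beta>"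
      using \<beta> by (intro divide_right_mono) auto
    thus ?thesis using \<beta>(1) by (simp add: abs_mult add_divide_distrib power2_eq_square)
  qed
  have "\<bar>\<Sum>j<n2. 2 * y j * h j\<bar> \<le> (\<Sum>j<n2. \<beta> * (y j)\<^sup>2 + (h j)\<^sup>2 / \<beta>)"
    by (rule order.trans[OF sum_abs sum_mono[OF amgm]])
  also have "\<dots> = \<beta> * (\<Sum>j<n2. (y j)\<^sup>2) + (\<Sum>j<n2. (h j)\<^sup>2) / \<beta>"
    by (simp add: sum.distrib sum_distrib_left sum_divide_distrib)
  also have "\<dots> \<le> \<beta> * (\<Sum>j<n2. (y j)\<^sup>2) + \<beta>\<^sup>2 * (\<Sum>i<n1. (x i)\<^sup>2) / \<beta>"
    using \<beta> h2 by (intro add_left_mono divide_right_mono) auto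
  also have "\<dots> = \<beta> * ((\<Sum>i<n1. (x i)\<^sup>2) + (\<Sum>j<n2. (y j)\<^sup>2))"
    using \<beta>(1) by (simp add: power2_eq_square algebra_simps)
  finally have "\<bar>\<Sum>j<n2. 2 * y j * h j\<bar> \<le> \<beta> * ((\<Sum>i<n1. (x i)\<^sup>2) + (\<Sum>j<n2. (y j)\<^sup>2))" .
  thus "\<bar>2 * (\<Sum>i<n1. \<Sum>j<n2. of_bool (f (i, j)) * (x i / sqrt (deg1 n2 f i)) * (y j / sqrt (deg2 n1 f j)))
        - 2 * (\<Sum>i<n1. 1 / (real n1 * sqrt (deg1 n2 f i)) * x i) * (\<Sum>j<n2. sqrt (deg2 n1 f j) * y j)\<bar>
        \<le> sqrt (\<kappa> / \<delta>) * ((\<Sum>i<n1. (x i)\<^sup>2) + (\<Sum>j<n2. (y j)\<^sup>2))"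
    unfolding eq[symmetric] unfolding u_def r_def s_def \<beta>_def .
qed

text \<open>Chernoff's method with exponent parameter 1: \<open>exp (- 1) \<le> 2 / 5\<close> gives
  the rate 3/5, and 3/5 - 9/16 = 3/80. The fraction 9/16 matches the norm constant 9/4, their
  quotient being 4.\<close>

lemma prob_bip_sum_small:
  assumes p: "0 \<le> p" "p \<le> 1" and S: "S \<subseteq> {..<n1} \<times> {..<n2}"
  shows "measure_pmf.prob (bip_pmf n1 n2 p) {f. (\<Sum>x\<in>S. of_bool (f x)) < 9 / 16 * (real (card S) * p)}
    \<le> exp (- 3 / 80 * (real (card S) * p))"
proof -
  define I where "I = {..<n1} \<times> {..<n2}"
  define m where "m = real (card S) * p"
  have fin: "finite I" "finite S" using S by (auto simp: I_def intro: finite_subset)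
  define u where "u f = (\<Prod>x\<in>I. if x \<in> S then exp (- of_bool (f x)) else (1::real))" for f :: "nat \<times> nat \<Rightarrow> bool"
  have u: "u f = exp (- (\<Sum>x\<in>S. of_bool (f x)))" for f
    using fin S unfolding u_def
    by (simp add: prod.If_cases exp_sum I_def Int_absorb1 flip: sum_negf del: sum_of_bool_eq)
  have "measure_pmf.expectation (bip_pmf n1 n2 p) u
    = (\<Prod>x\<in>I. measure_pmf.expectation (bernoulli_pmf p) (\<lambda>b. if x \<in> S then exp (- of_bool b) else 1))"
    unfolding u_def bip_pmf_def I_def[symmetric]
    by (rule expectation_prod_Pi_pmf_finite[OF fin(1)]) (auto intro: finite_subset[OF subset_UNIV])
  also have "\<dots> = (\<Prod>x\<in>I. if x \<in> S then p * exp (- 1) + (1 - p) else 1)"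
    using p by (intro prod.cong) auto
  also have "\<dots> = (p * exp (- 1) + (1 - p)) ^ card S"
    using fin S by (simp add: prod.If_cases I_def Int_absorb1)
  also have "\<dots> \<le> exp (- 3 / 5 * p) ^ card S"
  proof (rule power_mono)
    have "exp (1::real) \<ge> 5 / 2" using exp_lower_Taylor_quadratic[of "1::real"] by simp
    hence "exp (- 1 :: real) \<le> 2 / 5" by (simp add: exp_minus field_simps)
    hence "p * exp (- 1) \<le> p * (2 / 5)" using p by (intro mult_left_mono) auto
    moreover have "1 + (- 3 / 5 * p) \<le> exp (- 3 / 5 * p)" by (rule exp_ge_add_one_self)
    ultimately show "p * exp (- 1) + (1 - p) \<le> exp (- 3 / 5 * p)" by simp
  qed (use p in auto)
  also have "\<dots> = exp (- 3 / 5 * m)" by (simp add: m_def exp_of_nat_mult[symmetric] mult_ac)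
  finally have E: "measure_pmf.expectation (bip_pmf n1 n2 p) u \<le> exp (- 3 / 5 * m)" .
  have "measure_pmf.prob (bip_pmf n1 n2 p) {f. (\<Sum>x\<in>S. of_bool (f x)) < 9 / 16 * m}
     \<le> measure_pmf.prob (bip_pmf n1 n2 p) {f. u f \<ge> exp (- (9 / 16 * m))}"
    by (intro measure_pmf.finite_measure_mono) (auto simp: u)
  also have "\<dots> \<le> measure_pmf.expectation (bip_pmf n1 n2 p) u / exp (- (9 / 16 * m))"
    by (rule pmf_Markov_inequality[OF finite_bip_pmf]) (auto simp: u)
  also have "\<dots> \<le> exp (- 3 / 5 * m) / exp (- (9 / 16 * m))" using E by (intro divide_right_mono) auto
  also have "\<dots> = exp (- 3 / 80 * m)" by (simp flip: exp_diff)
  finally show ?thesis by (simp add: m_def)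
qed

lemma prob_ex_le:
  assumes "finite I" "\<And>i. i \<in> I \<Longrightarrow> measure_pmf.prob P {x. Q i x} \<le> b"
  shows "measure_pmf.prob P {x. \<exists>i\<in>I. Q i x} \<le> real (card I) * b"
proof -
  have "{x. \<exists>i\<in>I. Q i x} = (\<Union>i\<in>I. {x. Q i x})" by auto
  hence "measure_pmf.prob P {x. \<exists>i\<in>I. Q i x} \<le> (\<Sum>i\<in>I. measure_pmf.prob P {x. Q i x})"
    using measure_pmf.finite_measure_subadditive_finite[OF assms(1), of "\<lambda>i. {x. Q i x}"] by simp
  also have "\<dots> \<le> real (card I) * b" using assms sum_bounded_above[of I _ b] by simp
  finally show ?thesis .
qed

lemma prob_deg1_small:
  assumes p: "0 \<le> p" "p \<le> 1"
  shows "measure_pmf.prob (bip_pmf n1 n2 p) {f. \<exists>i\<in>{..<n1}. deg1 n2 f i < 9 / 16 * (real n2 * p)}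
    \<le> real n1 * exp (- 3 / 80 * (real n2 * p))"
proof -
  have "measure_pmf.prob (bip_pmf n1 n2 p) {f. deg1 n2 f i < 9 / 16 * (real n2 * p)}
    \<le> exp (- 3 / 80 * (real n2 * p))" if "i \<in> {..<n1}" for i
  proof -
    have inj: "inj_on (\<lambda>j. (i, j)) {..<n2}" by (auto simp: inj_on_def)
    from prob_bip_sum_small[OF p, of "(\<lambda>j. (i, j)) ` {..<n2}" n1 n2] that show ?thesis
      by (auto simp: card_image[OF inj] sum.reindex[OF inj] deg1_def image_subset_iff)
  qed
  from prob_ex_le[where Q = "\<lambda>i f. deg1 n2 f i < 9 / 16 * (real n2 * p)", OF finite_lessThan this]
  show ?thesis unfolding card_lessThan .
qed

lemma prob_deg2_small:
  assumes p: "0 \<le> p" "p \<le> 1"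
  shows "measure_pmf.prob (bip_pmf n1 n2 p) {f. \<exists>j\<in>{..<n2}. deg2 n1 f j < 9 / 16 * (real n1 * p)}
    \<le> real n2 * exp (- 3 / 80 * (real n1 * p))"
proof -
  have "measure_pmf.prob (bip_pmf n1 n2 p) {f. deg2 n1 f j < 9 / 16 * (real n1 * p)}
    \<le> exp (- 3 / 80 * (real n1 * p))" if "j \<in> {..<n2}" for j
  proof -
    have inj: "inj_on (\<lambda>i. (i, j)) {..<n1}" by (auto simp: inj_on_def)
    from prob_bip_sum_small[OF p, of "(\<lambda>i. (i, j)) ` {..<n1}" n1 n2] that show ?thesis
      by (auto simp: card_image[OF inj] sum.reindex[OF inj] deg2_def image_subset_iff)
  qed
  from prob_ex_le[where Q = "\<lambda>j f. deg2 n1 f j < 9 / 16 * (real n1 * p)", OF finite_lessThan this]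
  show ?thesis unfolding card_lessThan .
qed

section \<open>The two-step walk on the smaller side\<close>

text \<open>Uncorrelated summands leave only the diagonal of the expanded square, and a variance is
  at most the second moment.\<close>

lemma expectation_square_dev_sum_le:
  fixes Y :: "'b \<Rightarrow> 'a \<Rightarrow> real"
  assumes fin: "finite (set_pmf P)" and J: "finite J"
    and indep: "\<And>j l. j \<in> J \<Longrightarrow> l \<in> J \<Longrightarrow> j \<noteq> l \<Longrightarrow>
       measure_pmf.expectation P (\<lambda>\<omega>. Y j \<omega> * Y l \<omega>)
         = measure_pmf.expectation P (Y j) * measure_pmf.expectation P (Y l)"
  shows "measure_pmf.expectation P (\<lambda>\<omega>. ((\<Sum>j\<in>J. Y j \<omega>) - measure_pmf.expectation P (\<lambda>\<omega>. \<Sum>j\<in>J. Y j \<omega>))\<^sup>2)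
     \<le> (\<Sum>j\<in>J. measure_pmf.expectation P (\<lambda>\<omega>. (Y j \<omega>)\<^sup>2))"
proof -
  let ?E = "measure_pmf.expectation P"
  have int [simp]: "integrable (measure_pmf P) g" for g :: "'a \<Rightarrow> real"
    by (rule integrable_measure_pmf_finite[OF fin])
  define c where "c j = ?E (Y j)" for j
  have mean: "?E (\<lambda>\<omega>. \<Sum>j\<in>J. Y j \<omega>) = (\<Sum>j\<in>J. c j)" by (simp add: c_def)
  have "?E (\<lambda>\<omega>. ((\<Sum>j\<in>J. Y j \<omega>) - (\<Sum>j\<in>J. c j))\<^sup>2)
     = (\<Sum>j\<in>J. \<Sum>l\<in>J. ?E (\<lambda>\<omega>. (Y j \<omega> - c j) * (Y l \<omega> - c l)))"
    by (simp add: power2_eq_square sum_product flip: sum_subtractf)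
  also have "\<dots> = (\<Sum>j\<in>J. \<Sum>l\<in>J. if l = j then ?E (\<lambda>\<omega>. (Y j \<omega>)\<^sup>2) - (c j)\<^sup>2 else 0)"
  proof (intro sum.cong refl)
    fix j l assume jl: "j \<in> J" "l \<in> J"
    have "?E (\<lambda>\<omega>. (Y j \<omega> - c j) * (Y l \<omega> - c l)) = ?E (\<lambda>\<omega>. Y j \<omega> * Y l \<omega> - c l * Y j \<omega> - c j * Y l \<omega> + c j * c l)"
      by (simp add: algebra_simps)
    also have "\<dots> = ?E (\<lambda>\<omega>. Y j \<omega> * Y l \<omega>) - c j * c l" by (simp add: c_def)
    also have "\<dots> = (if l = j then ?E (\<lambda>\<omega>. (Y j \<omega>)\<^sup>2) - (c j)\<^sup>2 else 0)"
      using indep[of j l] jl by (auto simp: c_def power2_eq_square)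
    finally show "?E (\<lambda>\<omega>. (Y j \<omega> - c j) * (Y l \<omega> - c l))
       = (if l = j then ?E (\<lambda>\<omega>. (Y j \<omega>)\<^sup>2) - (c j)\<^sup>2 else 0)" .
  qed
  also have "\<dots> = (\<Sum>j\<in>J. ?E (\<lambda>\<omega>. (Y j \<omega>)\<^sup>2) - (c j)\<^sup>2)" using J by (simp add: sum.delta)
  also have "\<dots> \<le> (\<Sum>j\<in>J. ?E (\<lambda>\<omega>. (Y j \<omega>)\<^sup>2))" by (intro sum_mono) simp
  finally show ?thesis unfolding mean .
qed

text \<open>The source of exchangeability, which reduces the mean two-step matrix to one diagonal
  and one off-diagonal value.\<close>

lemma expectation_bip_pmf_permute:
  fixes F :: "(nat \<times> nat \<Rightarrow> bool) \<Rightarrow> real"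
  assumes \<pi>: "\<pi> permutes {..<n1}"
  shows "measure_pmf.expectation (bip_pmf n1 n2 p) F
    = measure_pmf.expectation (bip_pmf n1 n2 p) (\<lambda>f. F (\<lambda>(i, j). f (\<pi> i, j)))"
proof -
  have "bij_betw (map_prod \<pi> id) ({..<n1} \<times> {..<n2}) ({..<n1} \<times> {..<n2})"
    using \<pi> by (intro bij_betw_map_prod) (auto simp: permutes_imp_bij)
  moreover have "map_prod \<pi> id x \<notin> {..<n1} \<times> {..<n2}" if "x \<notin> {..<n1} \<times> {..<n2}" for x
    using that permutes_in_image[OF \<pi>] by (cases x) auto
  ultimately have "bip_pmf n1 n2 p = map_pmf (\<lambda>g. g \<circ> map_prod \<pi> id) (bip_pmf n1 n2 p)"
    unfolding bip_pmf_def by (intro Pi_pmf_bij_betw) auto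
  hence "measure_pmf.expectation (bip_pmf n1 n2 p) F
     = measure_pmf.expectation (map_pmf (\<lambda>g. g \<circ> map_prod \<pi> id) (bip_pmf n1 n2 p)) F" by simp
  also have "\<dots> = measure_pmf.expectation (bip_pmf n1 n2 p) (\<lambda>f. F (\<lambda>(i, j). f (\<pi> i, j)))"
    by (simp add: o_def map_prod_def case_prod_unfold)
  finally show ?thesis .
qed

text \<open>For fixed \<open>j\<close> this is the orthogonal projection onto the indicator vector
  of the neighbours of \<open>j\<close>, or the zero matrix if \<open>j\<close> is isolated, since
  division by 0 gives 0.\<close>

definition two_step_term :: "nat \<Rightarrow> (nat \<times> nat \<Rightarrow> bool) \<Rightarrow> nat \<Rightarrow> nat \<Rightarrow> nat \<Rightarrow> real" where
  "two_step_term n1 f i k j = of_bool (f (i, j)) * of_bool (f (k, j)) / deg2 n1 f j"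

definition two_step :: "nat \<Rightarrow> nat \<Rightarrow> (nat \<times> nat \<Rightarrow> bool) \<Rightarrow> nat \<Rightarrow> nat \<Rightarrow> real" where
  "two_step n1 n2 f i k = (\<Sum>j<n2. two_step_term n1 f i k j)"

definition two_step_mean :: "nat \<Rightarrow> nat \<Rightarrow> real \<Rightarrow> nat \<Rightarrow> nat \<Rightarrow> real" where
  "two_step_mean n1 n2 p i k = measure_pmf.expectation (bip_pmf n1 n2 p) (\<lambda>f. two_step n1 n2 f i k)"

lemma two_step_quad_form:
  "(\<Sum>j<n2. (\<Sum>i<n1. of_bool (f (i, j)) * z i)\<^sup>2 / deg2 n1 f j) = quad_form n1 (two_step n1 n2 f) z"
proof -
  have "(\<Sum>i<n1. of_bool (f (i, j)) * z i)\<^sup>2 / deg2 n1 f j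
     = (\<Sum>i<n1. \<Sum>k<n1. two_step_term n1 f i k j * z i * z k)" for j
    unfolding power2_eq_square sum_product sum_divide_distrib
    by (intro sum.cong refl) (simp add: two_step_term_def)
  hence "(\<Sum>j<n2. (\<Sum>i<n1. of_bool (f (i, j)) * z i)\<^sup>2 / deg2 n1 f j)
     = (\<Sum>j<n2. \<Sum>i<n1. \<Sum>k<n1. two_step_term n1 f i k j * z i * z k)" by simp
  also have "\<dots> = (\<Sum>i<n1. \<Sum>j<n2. \<Sum>k<n1. two_step_term n1 f i k j * z i * z k)" by (rule sum.swap)
  also have "\<dots> = (\<Sum>i<n1. \<Sum>k<n1. \<Sum>j<n2. two_step_term n1 f i k j * z i * z k)"
    by (intro sum.cong refl sum.swap)
  also have "\<dots> = quad_form n1 (two_step n1 n2 f) z"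
    by (simp add: quad_form_def two_step_def sum_distrib_right)
  finally show ?thesis .
qed

lemma sum_two_step_term_square_le:
  "(\<Sum>i<n1. \<Sum>k<n1. (two_step_term n1 f i k j)\<^sup>2) \<le> 1"
proof -
  have "(\<Sum>i<n1. \<Sum>k<n1. (two_step_term n1 f i k j)\<^sup>2)
      = (\<Sum>i<n1. \<Sum>k<n1. of_bool (f (i, j)) * of_bool (f (k, j))) / (deg2 n1 f j)\<^sup>2"
    unfolding sum_divide_distrib by (intro sum.cong refl) (auto simp: two_step_term_def power_divide)
  also have "\<dots> = (deg2 n1 f j)\<^sup>2 / (deg2 n1 f j)\<^sup>2"
    unfolding deg2_def power2_eq_square sum_product ..
  also have "\<dots> \<le> 1" by simp
  finally show ?thesis .
qed

text \<open>Different columns are independent, so their variances add up, and each projection has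
  squared Frobenius norm at most 1 whatever the degree of \<open>j\<close> is.\<close>

lemma expectation_two_step_dev_le:
  "measure_pmf.expectation (bip_pmf n1 n2 p)
     (\<lambda>f. \<Sum>i<n1. \<Sum>k<n1. (two_step n1 n2 f i k - two_step_mean n1 n2 p i k)\<^sup>2) \<le> real n2"
proof -
  let ?P = "bip_pmf n1 n2 p"
  let ?E = "measure_pmf.expectation ?P"
  have int [simp]: "integrable (measure_pmf ?P) g" for g :: "_ \<Rightarrow> real"
    by (rule integrable_measure_pmf_finite[OF finite_bip_pmf])
  have indep: "?E (\<lambda>f. two_step_term n1 f i k j * two_step_term n1 f i k l)
      = ?E (\<lambda>f. two_step_term n1 f i k j) * ?E (\<lambda>f. two_step_term n1 f i k l)"
    if "i < n1" "k < n1" "j < n2" "l < n2" "j \<noteq> l" for i k j l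
    unfolding bip_pmf_def
  proof (rule expectation_Pi_pmf_indep[where A = "{..<n1} \<times> {j}"])
    fix f f' :: "nat \<times> nat \<Rightarrow> bool"
    { assume *: "\<And>x. x \<in> {..<n1} \<times> {j} \<Longrightarrow> f x = f' x"
      have "deg2 n1 f j = deg2 n1 f' j" unfolding deg2_def using * by (intro sum.cong) auto
      thus "two_step_term n1 f i k j = two_step_term n1 f' i k j"
        using * that by (simp add: two_step_term_def) }
    { assume *: "\<And>x. x \<notin> {..<n1} \<times> {j} \<Longrightarrow> f x = f' x"
      have "deg2 n1 f l = deg2 n1 f' l" unfolding deg2_def using * that by (intro sum.cong) auto
      thus "two_step_term n1 f i k l = two_step_term n1 f' i k l"
        using * that by (simp add: two_step_term_def) }
  qed (use that in \<open>auto intro: finite_subset[OF subset_UNIV]\<close>)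
  have "?E (\<lambda>f. \<Sum>i<n1. \<Sum>k<n1. (two_step n1 n2 f i k - two_step_mean n1 n2 p i k)\<^sup>2)
     = (\<Sum>i<n1. \<Sum>k<n1. ?E (\<lambda>f. (two_step n1 n2 f i k - two_step_mean n1 n2 p i k)\<^sup>2))" by simp
  also have "\<dots> \<le> (\<Sum>i<n1. \<Sum>k<n1. \<Sum>j<n2. ?E (\<lambda>f. (two_step_term n1 f i k j)\<^sup>2))"
    unfolding two_step_mean_def two_step_def
    by (intro sum_mono expectation_square_dev_sum_le finite_bip_pmf) (auto intro!: indep)
  also have "\<dots> = ?E (\<lambda>f. \<Sum>i<n1. \<Sum>k<n1. \<Sum>j<n2. (two_step_term n1 f i k j)\<^sup>2)" by simp
  also have "\<dots> \<le> ?E (\<lambda>f. real n2)"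
  proof (intro integral_mono)
    fix f
    have "(\<Sum>i<n1. \<Sum>k<n1. \<Sum>j<n2. (two_step_term n1 f i k j)\<^sup>2)
       = (\<Sum>i<n1. \<Sum>j<n2. \<Sum>k<n1. (two_step_term n1 f i k j)\<^sup>2)"
      by (intro sum.cong refl sum.swap)
    also have "\<dots> = (\<Sum>j<n2. \<Sum>i<n1. \<Sum>k<n1. (two_step_term n1 f i k j)\<^sup>2)" by (rule sum.swap)
    also have "\<dots> \<le> (\<Sum>j<n2. 1)" by (intro sum_mono sum_two_step_term_square_le)
    finally show "(\<Sum>i<n1. \<Sum>k<n1. \<Sum>j<n2. (two_step_term n1 f i k j)\<^sup>2) \<le> real n2" by simp
  qed auto
  finally show ?thesis by simp
qed

lemma two_step_mean_permute:
  assumes \<pi>: "\<pi> permutes {..<n1}"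
  shows "two_step_mean n1 n2 p i k = two_step_mean n1 n2 p (\<pi> i) (\<pi> k)"
proof -
  have "two_step n1 n2 (\<lambda>(i, j). f (\<pi> i, j)) i k = two_step n1 n2 f (\<pi> i) (\<pi> k)" for f
  proof -
    have "deg2 n1 (\<lambda>(i, j). f (\<pi> i, j)) j = deg2 n1 f j" for j
      unfolding deg2_def using sum.permute[OF \<pi>, of "\<lambda>i. of_bool (f (i, j)) :: real"] by (simp add: o_def)
    thus ?thesis by (simp add: two_step_def two_step_term_def)
  qed
  thus ?thesis
    unfolding two_step_mean_def by (subst expectation_bip_pmf_permute[OF \<pi>]) simp
qed

lemma two_step_mean_diag:
  assumes "i < n1" "k < n1"
  shows "two_step_mean n1 n2 p i i = two_step_mean n1 n2 p k k"
  using two_step_mean_permute[OF permutes_swap_id[of i "{..<n1}" k], of n2 p i i] assms by simp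

lemma two_step_mean_offdiag:
  assumes "i < n1" "k < n1" "i \<noteq> k" "i' < n1" "k' < n1" "i' \<noteq> k'"
  shows "two_step_mean n1 n2 p i k = two_step_mean n1 n2 p i' k'"
proof -
  \<comment> \<open>Swapping \<open>i\<close> and \<open>i'\<close> leads to the pair
    \<open>i'\<close>, \<open>k''\<close>; swapping \<open>k''\<close> and \<open>k'\<close> then
    fixes \<open>i'\<close>.\<close>
  define k'' where "k'' = Transposition.transpose i i' k"
  have k'': "k'' < n1" "k'' \<noteq> i'"
    using assms by (auto simp: k''_def Transposition.transpose_def)
  have "two_step_mean n1 n2 p i k = two_step_mean n1 n2 p i' k''"
    using two_step_mean_permute[OF permutes_swap_id[of i "{..<n1}" i'], of n2 p i k] assms
    by (simp add: k''_def)
  also have "\<dots> = two_step_mean n1 n2 p i' k'"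
    using two_step_mean_permute[OF permutes_swap_id[of k'' "{..<n1}" k'], of n2 p i' k''] assms k''
    by (simp add: Transposition.transpose_def)
  finally show ?thesis .
qed

text \<open>Each non-isolated vertex of V2 contributes a projection of trace 1, and exchangeability
  spreads the total evenly over the diagonal.\<close>

lemma two_step_mean_diag_le:
  assumes "i < n1"
  shows "two_step_mean n1 n2 p i i \<le> real n2 / real n1"
proof -
  let ?E = "measure_pmf.expectation (bip_pmf n1 n2 p)"
  have int [simp]: "integrable (measure_pmf (bip_pmf n1 n2 p)) g" for g :: "_ \<Rightarrow> real"
    by (rule integrable_measure_pmf_finite[OF finite_bip_pmf])
  have "real n1 * two_step_mean n1 n2 p i i = (\<Sum>k<n1. two_step_mean n1 n2 p k k)"
    using two_step_mean_diag[OF _ assms, of _ n2 p] by simp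
  also have "\<dots> = ?E (\<lambda>f. \<Sum>k<n1. two_step n1 n2 f k k)" by (simp add: two_step_mean_def)
  also have "\<dots> \<le> ?E (\<lambda>f. real n2)"
  proof (intro integral_mono)
    fix f
    have "(\<Sum>k<n1. two_step n1 n2 f k k) = (\<Sum>j<n2. \<Sum>k<n1. two_step_term n1 f k k j)"
      unfolding two_step_def by (rule sum.swap)
    also have "\<dots> = (\<Sum>j<n2. deg2 n1 f j / deg2 n1 f j)"
    proof (intro sum.cong refl)
      fix j
      have "(\<Sum>k<n1. two_step_term n1 f k k j) = (\<Sum>k<n1. of_bool (f (k, j)) / deg2 n1 f j)"
        by (intro sum.cong) (auto simp: two_step_term_def)
      thus "(\<Sum>k<n1. two_step_term n1 f k k j) = deg2 n1 f j / deg2 n1 f j"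
        unfolding sum_divide_distrib[symmetric] by (simp only: deg2_def)
    qed
    also have "\<dots> \<le> (\<Sum>j<n2. 1)" by (intro sum_mono) simp
    finally show "(\<Sum>k<n1. two_step n1 n2 f k k) \<le> real n2" by simp
  qed auto
  finally show ?thesis using assms by (simp add: field_simps)
qed

lemma quad_form_square_le: "(quad_form n a z)\<^sup>2 \<le> (\<Sum>i<n. \<Sum>k<n. (a i k)\<^sup>2) * (\<Sum>i<n. (z i)\<^sup>2)\<^sup>2"
proof -
  let ?I = "{..<n} \<times> {..<n}"
  have "(quad_form n a z)\<^sup>2 = (\<Sum>x\<in>?I. a (fst x) (snd x) * (z (fst x) * z (snd x)))\<^sup>2"
    by (simp add: quad_form_def sum.cartesian_product case_prod_unfold mult.assoc)
  also have "\<dots> \<le> (\<Sum>x\<in>?I. (a (fst x) (snd x))\<^sup>2) * (\<Sum>x\<in>?I. (z (fst x) * z (snd x))\<^sup>2)"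
    by (rule Cauchy_Schwarz_ineq_sum)
  also have "(\<Sum>x\<in>?I. (z (fst x) * z (snd x))\<^sup>2) = (\<Sum>i<n. (z i)\<^sup>2)\<^sup>2"
    by (simp add: power2_eq_square[of "\<Sum>i<n. (z i)\<^sup>2"] sum_product sum.cartesian_product case_prod_unfold power_mult_distrib)
  finally show ?thesis by (simp add: sum.cartesian_product case_prod_unfold)
qed

text \<open>By exchangeability the mean is \<open>c\<close> times the all-ones matrix plus
  \<open>d - c\<close> times the identity. The first part vanishes on vectors of sum zero, and
  \<open>c \<ge> 0\<close> leaves at most \<open>d\<close>.\<close>

lemma two_step_mean_quad_form_le:
  assumes z: "(\<Sum>i<n1. z i) = 0"
  shows "quad_form n1 (two_step_mean n1 n2 p) z \<le> real n2 / real n1 * (\<Sum>i<n1. (z i)\<^sup>2)"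
proof -
  define d where "d = two_step_mean n1 n2 p 0 0"
  define c where "c = two_step_mean n1 n2 p 0 1"
  have c: "c \<ge> 0" unfolding c_def two_step_mean_def two_step_def two_step_term_def
    by (intro Bochner_Integration.integral_nonneg sum_nonneg) (auto simp: deg2_nonneg)
  have eq: "two_step_mean n1 n2 p i k = c + (d - c) * of_bool (i = k)" if "i < n1" "k < n1" for i k
    using that two_step_mean_diag[of i n1 0 n2 p] two_step_mean_offdiag[of i n1 k 0 1 n2 p]
    by (cases "i = k") (auto simp: c_def d_def)
  have "quad_form n1 (two_step_mean n1 n2 p) z = quad_form n1 (\<lambda>i k. c + (d - c) * of_bool (i = k)) z"
    by (rule quad_form_cong) (rule eq)
  also have "\<dots> = c * (\<Sum>i<n1. z i) * (\<Sum>k<n1. z k) + (d - c) * (\<Sum>i<n1. \<Sum>k<n1. of_bool (i = k) * z i * z k)"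
    unfolding quad_form_def distrib_right sum.distrib mult.assoc[of c] sum_product
    by (simp only: sum_distrib_left mult.assoc)
  also have "(\<Sum>i<n1. \<Sum>k<n1. of_bool (i = k) * z i * z k) = (\<Sum>i<n1. (z i)\<^sup>2)"
    by (intro sum.cong) (auto simp: of_bool_def if_distrib[of "\<lambda>z. z * _"] sum.delta power2_eq_square cong: if_cong)
  also have "c * (\<Sum>i<n1. z i) * (\<Sum>k<n1. z k) + (d - c) * (\<Sum>i<n1. (z i)\<^sup>2) \<le> d * (\<Sum>i<n1. (z i)\<^sup>2)"
    using z c by (simp add: left_diff_distrib sum_nonneg)
  also have "\<dots> \<le> real n2 / real n1 * (\<Sum>i<n1. (z i)\<^sup>2)"
  proof (cases "n1 = 0")
    case False
    thus ?thesis unfolding d_def by (intro mult_right_mono two_step_mean_diag_le) (auto simp: sum_nonneg)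
  qed simp
  finally show ?thesis .
qed

text \<open>Half of the bound is for the mean and half for the deviation. The latter fails with
  probability at most n2 / (n2 / n1)^2 by Markov's inequality.\<close>

lemma prob_two_step_large:
  assumes n: "n1 > 0" "n2 > 0"
  shows "measure_pmf.prob (bip_pmf n1 n2 p)
     {f. \<not> (\<forall>z. (\<Sum>i<n1. z i) = 0 \<longrightarrow>
         (\<Sum>j<n2. (\<Sum>i<n1. of_bool (f (i, j)) * z i)\<^sup>2 / deg2 n1 f j) \<le> 2 * real n2 / real n1 * (\<Sum>i<n1. (z i)\<^sup>2))}
     \<le> (real n1)\<^sup>2 / real n2"
proof -
  let ?P = "bip_pmf n1 n2 p"
  define r where "r = real n2 / real n1"
  have r: "r > 0" using n by (simp add: r_def)
  define F where "F f = (\<Sum>i<n1. \<Sum>k<n1. (two_step n1 n2 f i k - two_step_mean n1 n2 p i k)\<^sup>2)" for f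
  have good: "(\<Sum>j<n2. (\<Sum>i<n1. of_bool (f (i, j)) * z i)\<^sup>2 / deg2 n1 f j) \<le> 2 * real n2 / real n1 * (\<Sum>i<n1. (z i)\<^sup>2)"
    if z: "(\<Sum>i<n1. z i) = 0" and F: "F f < r\<^sup>2" for f z
  proof -
    define s where "s = (\<Sum>i<n1. (z i)\<^sup>2)"
    have s: "s \<ge> 0" by (simp add: s_def sum_nonneg)
    define q where "q = quad_form n1 (\<lambda>i k. two_step n1 n2 f i k - two_step_mean n1 n2 p i k) z"
    have "q\<^sup>2 \<le> F f * s\<^sup>2" unfolding q_def F_def s_def by (rule quad_form_square_le)
    also have "\<dots> \<le> r\<^sup>2 * s\<^sup>2" using F by (intro mult_right_mono) auto
    finally have "q\<^sup>2 \<le> (r * s)\<^sup>2" by (simp add: power_mult_distrib)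
    hence "q \<le> r * s" using r s by (meson mult_nonneg_nonneg order_less_imp_le power2_le_imp_le)
    moreover have "quad_form n1 (two_step n1 n2 f) z = q + quad_form n1 (two_step_mean n1 n2 p) z"
      by (simp add: q_def quad_form_def left_diff_distrib sum_subtractf)
    moreover have "quad_form n1 (two_step_mean n1 n2 p) z \<le> r * s"
      using two_step_mean_quad_form_le[OF z, of n2 p] by (simp only: r_def s_def)
    ultimately have "quad_form n1 (two_step n1 n2 f) z \<le> 2 * (r * s)" by linarith
    thus ?thesis unfolding two_step_quad_form by (simp add: r_def s_def)
  qed
  have "measure_pmf.prob ?P {f. \<not> (\<forall>z. (\<Sum>i<n1. z i) = 0 \<longrightarrow>
         (\<Sum>j<n2. (\<Sum>i<n1. of_bool (f (i, j)) * z i)\<^sup>2 / deg2 n1 f j) \<le> 2 * real n2 / real n1 * (\<Sum>i<n1. (z i)\<^sup>2))}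
     \<le> measure_pmf.prob ?P {f. F f \<ge> r\<^sup>2}"
    using good by (intro measure_pmf.finite_measure_mono) (auto simp: not_less[symmetric])
  also have "\<dots> \<le> measure_pmf.expectation ?P F / r\<^sup>2"
    using r by (intro pmf_Markov_inequality finite_bip_pmf) (auto simp: F_def sum_nonneg)
  also have "\<dots> \<le> real n2 / r\<^sup>2"
    using expectation_two_step_dev_le[of n1 n2 p] unfolding F_def by (intro divide_right_mono) auto
  also have "\<dots> = (real n1)\<^sup>2 / real n2" using n by (simp add: r_def power2_eq_square)
  finally show ?thesis .
qed

section \<open>Asymptotics\<close>

lemma ex_power_two_between:
  fixes y :: real
  assumes "y \<ge> 1"
  obtains t :: nat where "y \<le> 2 ^ t" "2 ^ t \<le> 2 * y"
proof -
  define t where "t = (LEAST t. y \<le> 2 ^ t)"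
  have "\<exists>t. y \<le> 2 ^ t" using real_arch_pow[of 2 y] by (auto intro: less_imp_le)
  hence y: "y \<le> 2 ^ t" unfolding t_def by (rule LeastI_ex)
  have "2 ^ t \<le> 2 * y"
  proof (cases t)
    case (Suc s)
    hence "\<not> y \<le> 2 ^ s" unfolding t_def using not_less_Least by (metis lessI)
    thus ?thesis using Suc by simp
  qed (use assms in simp)
  with y that show ?thesis by blast
qed

text \<open>\<open>c = 1 / r\<close> balances the main terms of \<open>growth\<close>. The walk
  length \<open>L\<close> is between \<open>36 * ln N\<close> and \<open>72 * ln N\<close>, hence at
  most \<open>144 * ln n2\<close>. By \<open>large\<close>, the error \<open>3 * L\<^sup>2\<close>
  is at most \<open>r / 8\<close>, so the growth is at most \<open>17 / 8 * r\<close>, which is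
  17/18 of the norm bound. The power \<open>L\<close> of 17/18 is at most
  \<open>exp (- L / 18)\<close>, hence at most \<open>1 / N\<^sup>2\<close>, and this beats the
  factor \<open>N\<close>.\<close>

lemma prob_bip_norm_small:
  assumes n: "n1 \<le> n2" "2 \<le> n2" and p: "0 \<le> p" "p \<le> 1" "p * real n2 > 0"
    and large: "24 * (144 * ln (real n2))\<^sup>2 \<le> sqrt (real n2 * p)"
  shows "measure_pmf.prob (bip_pmf n1 n2 p) {f. \<not> bip_norm_le n1 n2 p (9 / 4 * sqrt (real n2 * p)) f}
     \<le> 1 / real (n1 + n2)"
proof -
  define N where "N = real (n1 + n2)"
  define r where "r = sqrt (real n2 * p)"
  have r: "r > 0" using p by (simp add: r_def mult.commute)
  have N: "N \<ge> 2" using n by (simp add: N_def)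
  have "ln 2 \<ge> (1 / 2 :: real)" using ln2_ge_two_thirds by simp
  moreover have "ln N \<ge> ln 2" using N by simp
  ultimately have "18 * ln N \<ge> 1" by linarith
  then obtain t :: nat where t: "18 * ln N \<le> 2 ^ t" "2 ^ t \<le> 2 * (18 * ln N)"
    by (rule ex_power_two_between)
  define L :: real where "L = 2 * 2 ^ t"
  have L0: "L \<ge> 0" by (simp add: L_def)
  have "N \<le> (real n2)\<^sup>2"
  proof -
    have "N \<le> 2 * real n2" using n by (simp add: N_def)
    also have "\<dots> \<le> real n2 * real n2" using n by (intro mult_right_mono) auto
    finally show ?thesis by (simp add: power2_eq_square)
  qed
  hence "ln N \<le> ln ((real n2)\<^sup>2)" using N by (intro ln_mono) auto
  also have "\<dots> = 2 * ln (real n2)" using n by (simp add: ln_realpow)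
  finally have "L \<le> 144 * ln (real n2)" using t by (simp add: L_def)
  hence "L\<^sup>2 \<le> (144 * ln (real n2))\<^sup>2" using L0 by (intro power_mono) auto
  hence L2: "24 * L\<^sup>2 \<le> r" using large by (simp add: r_def)
  have pr: "p / r \<le> 1"
  proof -
    have "p\<^sup>2 \<le> real n2 * p" using p n unfolding power2_eq_square by (intro mult_right_mono) auto
    hence "p \<le> r" unfolding r_def by (rule real_le_rsqrt)
    thus ?thesis using r by simp
  qed
  have rr: "p * (1 / r) * real n2 = r"
    using r p by (simp add: r_def real_div_sqrt mult.commute)
  have "p * (1 / r) * (real n2 + 2 * L\<^sup>2) + 1 / (1 / r) + L\<^sup>2 = 2 * r + (p / r) * (2 * L\<^sup>2) + L\<^sup>2"
    using rr by (simp add: distrib_left)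
  also have "\<dots> \<le> 2 * r + 1 * (2 * L\<^sup>2) + L\<^sup>2"
    using mult_right_mono[OF pr, of "2 * L\<^sup>2"] by simp
  also have "\<dots> \<le> 17 / 8 * r" using L2 by simp
  finally have g: "p * (1 / r) * (real n2 + 2 * L\<^sup>2) + 1 / (1 / r) + L\<^sup>2 \<le> 17 / 8 * r" .
  have "measure_pmf.prob (bip_pmf n1 n2 p) {f. \<not> bip_norm_le n1 n2 p (9 / 4 * r) f}
    \<le> N * ((p * (1 / r) * (real n2 + 2 * L\<^sup>2) + 1 / (1 / r) + L\<^sup>2) / (9 / 4 * r)) ^ (2 * 2 ^ t)"
    unfolding N_def L_def using n p r by (intro prob_bip_norm) auto
  also have "\<dots> \<le> N * (17 / 18) ^ (2 * 2 ^ t)"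
  proof (intro mult_left_mono power_mono)
    show "(p * (1 / r) * (real n2 + 2 * L\<^sup>2) + 1 / (1 / r) + L\<^sup>2) / (9 / 4 * r) \<le> 17 / 18"
      using g r by (simp add: divide_le_eq)
    show "0 \<le> (p * (1 / r) * (real n2 + 2 * L\<^sup>2) + 1 / (1 / r) + L\<^sup>2) / (9 / 4 * r)"
      using p r by simp
  qed (use N in auto)
  also have "\<dots> \<le> N * exp (- 1 / 18) ^ (2 * 2 ^ t)"
    using exp_ge_add_one_self[of "- 1 / 18 :: real"] N by (intro mult_left_mono power_mono) auto
  also have "exp (- 1 / 18 :: real) ^ (2 * 2 ^ t) = exp (- (L / 18))"
    by (simp add: L_def exp_of_nat_mult[symmetric])
  also have "N * exp (- (L / 18)) \<le> N * exp (- (2 * ln N))"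
    using t N by (intro mult_left_mono) (auto simp: L_def)
  also have "exp (- (2 * ln N)) = 1 / N\<^sup>2"
    using N by (simp add: exp_minus exp_double inverse_eq_divide)
  also have "N * (1 / N\<^sup>2) = 1 / N" using N by (simp add: power2_eq_square)
  finally show ?thesis by (simp add: r_def N_def)
qed

section \<open>Probability bounds at a fixed size of the graph\<close>

lemma prob_ge_of_bad:
  assumes "\<And>x. \<not> B x \<Longrightarrow> Q x" "measure_pmf.prob P {x. B x} \<le> b"
  shows "measure_pmf.prob P {x. Q x} \<ge> 1 - b"
proof -
  have "1 - measure_pmf.prob P {x. B x} = measure_pmf.prob P (- {x. B x})"
    using measure_pmf.prob_compl[of "{x. B x}" P] by (simp add: Compl_eq_Diff_UNIV)
  also have "\<dots> \<le> measure_pmf.prob P {x. Q x}"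
    using assms(1) by (intro measure_pmf.finite_measure_mono) auto
  finally show ?thesis using assms(2) by linarith
qed

lemma prob_disj_le:
  assumes "measure_pmf.prob P {x. A x} \<le> a" "measure_pmf.prob P {x. B x} \<le> b"
  shows "measure_pmf.prob P {x. A x \<or> B x} \<le> a + b"
proof -
  have "{x. A x \<or> B x} = {x. A x} \<union> {x. B x}" by auto
  thus ?thesis using measure_Un_le[of "{x. A x}" "measure_pmf P" "{x. B x}"] assms by simp
qed

lemma mu_adjacency_prob:
  assumes n: "n1 \<le> n2" "2 \<le> n1" and p: "0 \<le> p" "p \<le> 1" "p * real n2 > 0"
    and large: "24 * (144 * ln (real n2))\<^sup>2 \<le> sqrt (real n2 * p)"
  shows "measure_pmf.prob (random_bipartite n1 n2 p)
     {E. mu 2 (adjacency_matrix (n1 + n2) E)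
        \<le> 2 * (sqrt (real (n1 + n2) * p) + sqrt (real n1 * p) + sqrt (real n2 * p))} \<ge> 1 - 1 / real n1"
  unfolding prob_random_bipartite
proof (rule prob_ge_of_bad[where B = "\<lambda>f. \<not> bip_norm_le n1 n2 p (9 / 4 * sqrt (real n2 * p)) f"])
  fix f assume "\<not> \<not> bip_norm_le n1 n2 p (9 / 4 * sqrt (real n2 * p)) f"
  hence "mu 2 (adjacency_matrix (n1 + n2) (bip_edges n1 n2 f)) \<le> 9 / 4 * sqrt (real n2 * p)"
    using n by (intro mu_adjacency_le) auto
  also have "\<dots> \<le> 2 * (sqrt (real n2 * p) + sqrt (real n1 * p) + sqrt (real n2 * p))"
    using p by (simp add: sum_nonneg)
  also have "\<dots> \<le> 2 * (sqrt (real (n1 + n2) * p) + sqrt (real n1 * p) + sqrt (real n2 * p))"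
    using p by (intro mult_left_mono add_right_mono real_sqrt_le_mono mult_right_mono) auto
  finally show "mu 2 (adjacency_matrix (n1 + n2) (bip_edges n1 n2 f))
    \<le> 2 * (sqrt (real (n1 + n2) * p) + sqrt (real n1 * p) + sqrt (real n2 * p))" .
next
  have "1 / real (n1 + n2) \<le> 1 / real n1" using n by (intro divide_left_mono) auto
  with prob_bip_norm_small[OF n(1) _ p large] n
  show "measure_pmf.prob (bip_pmf n1 n2 p) {f. \<not> bip_norm_le n1 n2 p (9 / 4 * sqrt (real n2 * p)) f} \<le> 1 / real n1"
    by linarith
qed

lemma mu_graph_prob:
  assumes n: "n1 \<le> n2" "2 \<le> n1" and p: "0 \<le> p" "p \<le> 1" "p * real n1 > 0"
    and large: "24 * (144 * ln (real n2))\<^sup>2 \<le> sqrt (real n2 * p)"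
    and large1: "107 * ln (real n1) \<le> real n1 * p"
  shows "measure_pmf.prob (random_bipartite n1 n2 p)
     {E. Max ((\<lambda>i. \<bar>mu_graph i (n1 + n2) E - 1\<bar>) ` ({1..n1 + n2} - {1, n1 + n2}))
        \<le> 2 * (sqrt (1 / (real n1 * p) + 1 / (real n2 * p)) + 1 / sqrt (real n1 * p) + 1 / sqrt (real n2 * p))}
     \<ge> 1 - 3 / real n1"
proof -
  have p0: "p > 0" using p by (simp add: zero_less_mult_iff)
  have p2: "p * real n2 > 0" using p0 n by simp
  define a1 where "a1 = real n1 * p"
  define a2 where "a2 = real n2 * p"
  have a: "a1 > 0" "a2 > 0" "a1 \<le> a2" using p0 n by (auto simp: a1_def a2_def)
  \<comment> \<open>The first two summands of the target are each at least
    \<open>1 / sqrt a1\<close>, so both cases only have to reach \<open>\<beta>\<close>.\<close>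
  define \<beta> where "\<beta> = 4 / sqrt a1"
  have rhs: "\<beta> \<le> 2 * (sqrt (1 / a1 + 1 / a2) + 1 / sqrt a1 + 1 / sqrt a2)"
  proof -
    have "1 / sqrt a1 = sqrt (1 / a1)" by (simp add: real_sqrt_divide)
    also have "\<dots> \<le> sqrt (1 / a1 + 1 / a2)" using a by simp
    finally have "1 / sqrt a1 \<le> sqrt (1 / a1 + 1 / a2)" .
    moreover have "1 / sqrt a2 \<ge> 0" using a by simp
    moreover have "4 * u \<le> 2 * (s + u + v)" if "u \<le> s" "0 \<le> v" for s u v :: real
      using that by simp
    ultimately have "4 * (1 / sqrt a1) \<le> 2 * (sqrt (1 / a1 + 1 / a2) + 1 / sqrt a1 + 1 / sqrt a2)" by blast
    thus ?thesis by (simp add: \<beta>_def)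
  qed
  have max: "Max ((\<lambda>i. \<bar>mu_graph i (n1 + n2) E - 1\<bar>) ` ({1..n1 + n2} - {1, n1 + n2}))
      \<le> 2 * (sqrt (1 / a1 + 1 / a2) + 1 / sqrt a1 + 1 / sqrt a2)"
    if "\<And>i. 1 < i \<Longrightarrow> i < n1 + n2 \<Longrightarrow> \<bar>mu_graph i (n1 + n2) E - 1\<bar> \<le> \<beta>" for E
  proof (rule Max.boundedI)
    have "2 \<in> {1..n1 + n2} - {1, n1 + n2}" using n by auto
    thus "(\<lambda>i. \<bar>mu_graph i (n1 + n2) E - 1\<bar>) ` ({1..n1 + n2} - {1, n1 + n2}) \<noteq> {}" by blast
  next
    fix a assume "a \<in> (\<lambda>i. \<bar>mu_graph i (n1 + n2) E - 1\<bar>) ` ({1..n1 + n2} - {1, n1 + n2})"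
    then obtain i where i: "a = \<bar>mu_graph i (n1 + n2) E - 1\<bar>" "i \<in> {1..n1 + n2} - {1, n1 + n2}" by blast
    hence "1 < i" "i < n1 + n2" by auto
    with i(1) show "a \<le> 2 * (sqrt (1 / a1 + 1 / a2) + 1 / sqrt a1 + 1 / sqrt a2)"
      using that[of i] rhs by linarith
  qed simp
  \<comment> \<open>3/80 times 107 exceeds 4, and the fourth power survives a union bound over up to
    \<open>n1 ^ 3\<close> vertices.\<close>
  have ex: "exp (- 3 / 80 * a1) \<le> 1 / real n1 ^ 4"
  proof -
    have l: "ln (real n1) \<ge> 0" using n by simp
    have "4 * ln (real n1) \<le> 3 / 80 * (107 * ln (real n1))" using l by simp
    also have "\<dots> \<le> 3 / 80 * a1" using large1 unfolding a1_def by (intro mult_left_mono) auto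
    finally have "- 3 / 80 * a1 \<le> - (4 * ln (real n1))" by simp
    hence "exp (- 3 / 80 * a1) \<le> exp (- (4 * ln (real n1)))" by simp
    also have "4 * ln (real n1) = ln (real n1 ^ 4)" using n by (simp add: ln_realpow)
    also have "exp (- ln (real n1 ^ 4)) = 1 / real n1 ^ 4" using n by (simp add: exp_minus inverse_eq_divide)
    finally show ?thesis .
  qed
  have ex2: "exp (- 3 / 80 * a2) \<le> 1 / real n1 ^ 4"
    using a(3) by (intro order.trans[OF _ ex]) simp
  define B1 where "B1 f \<longleftrightarrow> (\<exists>i\<in>{..<n1}. deg1 n2 f i < 9 / 16 * a2)" for f
  have B1: "measure_pmf.prob (bip_pmf n1 n2 p) {f. B1 f} \<le> 1 / real n1"
  proof -
    have "measure_pmf.prob (bip_pmf n1 n2 p) {f. B1 f} \<le> real n1 * exp (- 3 / 80 * a2)"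
      unfolding B1_def a2_def using p by (intro prob_deg1_small) auto
    also have "\<dots> \<le> real n1 * (1 / real n1 ^ 4)" using ex2 by (intro mult_left_mono) auto
    also have "\<dots> = 1 / real n1 ^ 3" using n by (simp add: field_simps eval_nat_numeral)
    also have "\<dots> \<le> 1 / real n1" using n self_le_power[of "real n1" 3] by (intro divide_left_mono) auto
    finally show ?thesis .
  qed
  show ?thesis
  proof (cases "n2 \<le> n1 ^ 3")
    case True
    define B2 where "B2 f \<longleftrightarrow> (\<exists>j\<in>{..<n2}. deg2 n1 f j < 9 / 16 * a1)" for f
    have B2: "measure_pmf.prob (bip_pmf n1 n2 p) {f. B2 f} \<le> 1 / real n1"
    proof -
      have "measure_pmf.prob (bip_pmf n1 n2 p) {f. B2 f} \<le> real n2 * exp (- 3 / 80 * a1)"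
        unfolding B2_def a1_def using p by (intro prob_deg2_small) auto
      also have "\<dots> \<le> real n1 ^ 3 * (1 / real n1 ^ 4)"
        using ex True by (intro mult_mono) (auto simp flip: of_nat_power)
      also have "\<dots> = 1 / real n1" using n by (simp add: field_simps eval_nat_numeral)
      finally show ?thesis .
    qed
    define B3 where "B3 f \<longleftrightarrow> \<not> bip_norm_le n1 n2 p (9 / 4 * sqrt a2) f" for f
    have B3: "measure_pmf.prob (bip_pmf n1 n2 p) {f. B3 f} \<le> 1 / real n1"
    proof -
      have "measure_pmf.prob (bip_pmf n1 n2 p) {f. B3 f} \<le> 1 / real (n1 + n2)"
        unfolding B3_def a2_def using n p p2 large by (intro prob_bip_norm_small) auto
      also have "\<dots> \<le> 1 / real n1" using n by (intro divide_left_mono) auto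
      finally show ?thesis .
    qed
    show ?thesis
      unfolding prob_random_bipartite a1_def[symmetric] a2_def[symmetric]
    proof (rule prob_ge_of_bad[where B = "\<lambda>f. (B1 f \<or> B2 f) \<or> B3 f"], rule max)
      fix f i assume f: "\<not> ((B1 f \<or> B2 f) \<or> B3 f)" and i: "1 < i" "i < n1 + n2"
      have "\<bar>mu_graph i (n1 + n2) (bip_edges n1 n2 f) - 1\<bar> \<le> 9 / 4 * sqrt a2 / sqrt ((9 / 16 * a2) * (9 / 16 * a1))"
        using f i a by (intro mu_graph_near_of_degrees[where p = p]) (auto simp: B1_def B2_def B3_def not_less)
      also have "sqrt ((9 / 16 * a2) * (9 / 16 * a1)) = 9 / 16 * (sqrt a2 * sqrt a1)"
      proof -
        have "(9 / 16 * a2) * (9 / 16 * a1) = (9 / 16)\<^sup>2 * (a2 * a1)" by (simp add: power2_eq_square)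
        thus ?thesis by (simp only: real_sqrt_mult real_sqrt_abs)
      qed
      also have "9 / 4 * sqrt a2 / (9 / 16 * (sqrt a2 * sqrt a1)) = \<beta>" using a by (simp add: \<beta>_def)
      finally show "\<bar>mu_graph i (n1 + n2) (bip_edges n1 n2 f) - 1\<bar> \<le> \<beta>" .
    next
      show "measure_pmf.prob (bip_pmf n1 n2 p) {f. (B1 f \<or> B2 f) \<or> B3 f} \<le> 3 / real n1"
        using prob_disj_le[OF prob_disj_le[OF B1 B2] B3] by (simp add: add_divide_distrib[symmetric])
    qed
  next
    case False
    define B2 where "B2 f \<longleftrightarrow> \<not> (\<forall>z. (\<Sum>i<n1. z i) = 0 \<longrightarrow>
         (\<Sum>j<n2. (\<Sum>i<n1. of_bool (f (i, j)) * z i)\<^sup>2 / deg2 n1 f j) \<le> 2 * real n2 / real n1 * (\<Sum>i<n1. (z i)\<^sup>2))" for f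
    have B2: "measure_pmf.prob (bip_pmf n1 n2 p) {f. B2 f} \<le> 1 / real n1"
    proof -
      have "measure_pmf.prob (bip_pmf n1 n2 p) {f. B2 f} \<le> (real n1)\<^sup>2 / real n2"
        unfolding B2_def using n by (intro prob_two_step_large) auto
      also have "\<dots> \<le> (real n1)\<^sup>2 / real n1 ^ 3"
        using False n by (intro divide_left_mono mult_pos_pos) (auto simp flip: of_nat_power)
      also have "\<dots> = 1 / real n1" using n by (simp add: field_simps eval_nat_numeral)
      finally show ?thesis .
    qed
    show ?thesis
      unfolding prob_random_bipartite a1_def[symmetric] a2_def[symmetric]
    proof (rule prob_ge_of_bad[where B = "\<lambda>f. B1 f \<or> B2 f"], rule max)
      fix f i assume f: "\<not> (B1 f \<or> B2 f)" and i: "1 < i" "i < n1 + n2"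
      have "\<bar>mu_graph i (n1 + n2) (bip_edges n1 n2 f) - 1\<bar> \<le> sqrt (2 * real n2 / real n1 / (9 / 16 * a2))"
        using f i a n by (intro mu_graph_near_of_two_step) (auto simp: B1_def B2_def not_less)
      also have "2 * real n2 / real n1 / (9 / 16 * a2) = 32 / 9 / a1"
        using n p0 by (simp add: a1_def a2_def)
      also have "sqrt (32 / 9 / a1) \<le> sqrt (16 / a1)" using a by (intro real_sqrt_le_mono divide_right_mono) auto
      also have "\<dots> = \<beta>" by (simp add: \<beta>_def real_sqrt_divide)
      finally show "\<bar>mu_graph i (n1 + n2) (bip_edges n1 n2 f) - 1\<bar> \<le> \<beta>" .
    next
      have "1 / real n1 + 1 / real n1 \<le> 3 / real n1" using n by (simp add: field_simps)
      with prob_disj_le[OF B1 B2]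
      show "measure_pmf.prob (bip_pmf n1 n2 p) {f. B1 f \<or> B2 f} \<le> 3 / real n1" by linarith
    qed
  qed
qed

lemma little_o_sqrt_ln:
  assumes "little_o (\<lambda>n. sqrt (a n) * (ln (b n)) ^ 3) a"
  shows "\<forall>\<^sub>F n in sequentially. a n > 0 \<and> (ln (b n)) ^ 3 \<le> sqrt (a n)"
proof -
  have pos: "\<forall>\<^sub>F n in sequentially. a n > 0"
    and lim: "(\<lambda>n. sqrt (a n) * (ln (b n)) ^ 3 / a n) \<longlonglongrightarrow> 0"
    using assms by (auto simp: little_o_def)
  have "\<forall>\<^sub>F n in sequentially. sqrt (a n) * (ln (b n)) ^ 3 / a n < 1"
    using order_tendstoD(2)[OF lim, of 1] by simp
  with pos show ?thesis
  proof eventually_elim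
    case (elim n)
    have "sqrt (a n) * (ln (b n)) ^ 3 < a n" using elim by (simp add: divide_less_eq)
    also have "a n = sqrt (a n) * sqrt (a n)" using elim by simp
    finally have "(ln (b n)) ^ 3 < sqrt (a n)" using elim by (subst (asm) mult_less_cancel_left_pos) auto
    thus ?case using elim by simp
  qed
qed

lemma tendsto_1_of_prob_ge:
  fixes q :: "nat \<Rightarrow> real"
  assumes "\<forall>\<^sub>F n in sequentially. 1 - c / real n \<le> q n" "\<And>n. q n \<le> 1"
  shows "q \<longlonglongrightarrow> 1"
proof (rule tendsto_sandwich[OF assms(1)])
  show "(\<lambda>n. 1 - c / real n) \<longlonglongrightarrow> 1"
    using tendsto_diff[OF tendsto_const lim_const_over_n[of c], of 1] by simp
qed (use assms(2) in auto)

theorem theoremA: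
  fixes n2 :: "nat \<Rightarrow> nat" and p :: "nat \<Rightarrow> real"
  assumes "\<And>n1. n2 n1 \<ge> n1"
    and "\<And>n1. 0 \<le> p n1 \<and> p n1 \<le> 1"
    and "little_o (\<lambda>n1. sqrt (real n1 * p n1) * (ln (real n1)) ^ 3) (\<lambda>n1. real n1 * p n1)"
    and "little_o (\<lambda>n1. sqrt (real (n2 n1) * p n1) * (ln (real (n2 n1))) ^ 3)
           (\<lambda>n1. real (n2 n1) * p n1)"
  shows "(\<exists>\<epsilon> :: nat \<Rightarrow> real. \<epsilon> \<longlonglongrightarrow> 0 \<and>
            (\<lambda>n1. measure_pmf.prob (random_bipartite n1 (n2 n1) (p n1))
               {E. mu 2 (adjacency_matrix (n1 + n2 n1) E)
                   \<le> 2 * (1 + \<epsilon> n1) *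
                      (sqrt (real (n1 + n2 n1) * p n1) + sqrt (real n1 * p n1)
                       + sqrt (real (n2 n1) * p n1))}) \<longlonglongrightarrow> 1)
       \<and> (\<exists>\<epsilon>' :: nat \<Rightarrow> real. \<epsilon>' \<longlonglongrightarrow> 0 \<and>
            (\<lambda>n1. measure_pmf.prob (random_bipartite n1 (n2 n1) (p n1))
               {E. Max ((\<lambda>i. \<bar>mu_graph i (n1 + n2 n1) E - 1\<bar>) ` ({1..n1 + n2 n1} - {1, n1 + n2 n1}))
                   \<le> 2 * (1 + \<epsilon>' n1) *
                      (sqrt (1 / (real n1 * p n1) + 1 / (real (n2 n1) * p n1))
                       + 1 / sqrt (real n1 * p n1) + 1 / sqrt (real (n2 n1) * p n1))}) \<longlonglongrightarrow> 1)"
proof -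
  \<comment> \<open>The constant in \<open>24 * (144 * l)\<^sup>2 = C * l\<^sup>2\<close>. Once
    \<open>ln n1 \<ge> C\<close>, the third logarithm in the hypothesis absorbs it, and
    \<open>C \<ge> 107\<close> serves the degree condition.\<close>
  define C :: real where "C = 24 * 144\<^sup>2"
  have "filterlim (\<lambda>n. ln (real n)) at_top sequentially"
    by (rule filterlim_compose[OF ln_at_top filterlim_real_sequentially])
  hence "\<forall>\<^sub>F n1 in sequentially. ln (real n1) \<ge> C" by (simp add: filterlim_at_top)
  moreover have "\<forall>\<^sub>F n1 in sequentially. n1 \<ge> 2" by (rule eventually_ge_at_top)
  ultimately have ev: "\<forall>\<^sub>F n1 in sequentially. n1 \<ge> 2 \<and> p n1 * real n1 > 0 \<and> p n1 * real (n2 n1) > 0 \<and>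
      24 * (144 * ln (real (n2 n1)))\<^sup>2 \<le> sqrt (real (n2 n1) * p n1) \<and>
      107 * ln (real n1) \<le> real n1 * p n1"
    using little_o_sqrt_ln[OF assms(3)] little_o_sqrt_ln[OF assms(4)]
  proof eventually_elim
    case (elim n1)
    define l1 where "l1 = ln (real n1)"
    define l2 where "l2 = ln (real (n2 n1))"
    have l1: "l1 \<ge> C" using elim by (simp add: l1_def)
    have "l1 \<le> l2" using elim assms(1)[of n1] by (simp add: l1_def l2_def)
    hence l2: "l2 \<ge> C" using l1 by simp
    have C: "C \<ge> 107" by (simp add: C_def)
    have "24 * (144 * l2)\<^sup>2 = C * l2\<^sup>2" by (simp add: C_def power_mult_distrib)
    also have "\<dots> \<le> l2 * l2\<^sup>2" using l2 by (intro mult_right_mono) auto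
    also have "\<dots> = l2 ^ 3" by (simp add: eval_nat_numeral)
    also have "\<dots> \<le> sqrt (real (n2 n1) * p n1)" using elim by (simp add: l2_def)
    finally have A: "24 * (144 * l2)\<^sup>2 \<le> sqrt (real (n2 n1) * p n1)" .
    have "107 * l1 \<le> l1 * l1" using l1 C by (intro mult_right_mono) auto
    also have "\<dots> = l1 ^ 2" by (simp add: power2_eq_square)
    also have "\<dots> \<le> l1 ^ 6" using l1 C by (intro power_increasing) auto
    also have "\<dots> = (l1 ^ 3)\<^sup>2" by simp
    also have "\<dots> \<le> (sqrt (real n1 * p n1))\<^sup>2"
      using elim l1 C by (intro power_mono) (auto simp: l1_def)
    also have "\<dots> = real n1 * p n1" using elim by simp
    finally have B: "107 * l1 \<le> real n1 * p n1" .
    show ?case using elim A B by (simp add: l1_def l2_def mult.commute)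
  qed
  have "(\<lambda>n1. measure_pmf.prob (random_bipartite n1 (n2 n1) (p n1))
               {E. mu 2 (adjacency_matrix (n1 + n2 n1) E)
                   \<le> 2 * (1 + 0) *
                      (sqrt (real (n1 + n2 n1) * p n1) + sqrt (real n1 * p n1)
                       + sqrt (real (n2 n1) * p n1))}) \<longlonglongrightarrow> 1"
    unfolding add_0_right mult_1_right
  proof (rule tendsto_1_of_prob_ge[where c = 1])
    show "\<forall>\<^sub>F n1 in sequentially. 1 - 1 / real n1 \<le> measure_pmf.prob (random_bipartite n1 (n2 n1) (p n1))
               {E. mu 2 (adjacency_matrix (n1 + n2 n1) E)
                   \<le> 2 * (sqrt (real (n1 + n2 n1) * p n1) + sqrt (real n1 * p n1)
                       + sqrt (real (n2 n1) * p n1))}"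
      using ev by eventually_elim (use assms(1,2) in \<open>intro mu_adjacency_prob; simp\<close>)
  qed simp
  moreover have "(\<lambda>n1. measure_pmf.prob (random_bipartite n1 (n2 n1) (p n1))
               {E. Max ((\<lambda>i. \<bar>mu_graph i (n1 + n2 n1) E - 1\<bar>) ` ({1..n1 + n2 n1} - {1, n1 + n2 n1}))
                   \<le> 2 * (1 + 0) *
                      (sqrt (1 / (real n1 * p n1) + 1 / (real (n2 n1) * p n1))
                       + 1 / sqrt (real n1 * p n1) + 1 / sqrt (real (n2 n1) * p n1))}) \<longlonglongrightarrow> 1"
    unfolding add_0_right mult_1_right
  proof (rule tendsto_1_of_prob_ge[where c = 3])
    show "\<forall>\<^sub>F n1 in sequentially. 1 - 3 / real n1 \<le> measure_pmf.prob (random_bipartite n1 (n2 n1) (p n1))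
               {E. Max ((\<lambda>i. \<bar>mu_graph i (n1 + n2 n1) E - 1\<bar>) ` ({1..n1 + n2 n1} - {1, n1 + n2 n1}))
                   \<le> 2 * (sqrt (1 / (real n1 * p n1) + 1 / (real (n2 n1) * p n1))
                       + 1 / sqrt (real n1 * p n1) + 1 / sqrt (real (n2 n1) * p n1))}"
      using ev by eventually_elim (use assms(1,2) in \<open>intro mu_graph_prob; simp\<close>)
  qed simp
  ultimately show ?thesis by (intro conjI exI[of _ "\<lambda>_. 0"]) auto
qed

end
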